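(* There exist universal constants $c_0,c_1>0$ such that, for every $L,\Delta_\Phi,D_{\mathcal Y}>0$ and every $\epsilon$ satisfying $$0<\epsilon\le c_1\min\{\sqrt{L\Delta_\Phi},\,L D_{\mathcal Y}\},$$ there is an instance $f\in\mathcal F_{\rm NCC}(L,\Delta_\Phi,D_{\mathcal Y})$ on finite-dimensional closed convex sets $X_0,Y_0$, with $\operatorname{diam}(Y_0)=D_{\mathcal Y}$, for which the following holds. Let $\Phi(x):=\max_{y\in Y_0}f(x,y)$ for $x\in X_0$ and $\varphi:=\Phi+\iota_{X_0}$. For any deterministic zero-respecting first-order algorithm, every zero-respecting primal output $x\in X_0$ produced after $q$ joint oracle calls with $$q<c_0L^2D_{\mathcal Y}\Delta_\Phi\,\epsilon^{-3}$$ satisfies $$\|\nabla\varphi_{1/(2L)}(x)\|=\|G_{1/(2L)}(x;p)\|>\epsilon,$$ where $p$ is the unique point in $\mathcal P_{1/(2L)}(x)$. Consequently, the deterministic zero-respecting first-order oracle complexity of finding an $\epsilon$-stationary point is $\Omega(L^2D_{\mathcal Y}\Delta_\Phi\,\epsilon^{-3})$, with a universal implied constant.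
   Context: All norms are Euclidean. For a vector $v$, $\operatorname{supp}(v)$ is the set of indices of its nonzero coordinates. For a nonempty closed convex set $C$, $\iota_C$ is its indicator function ($0$ on $C$, $+\infty$ off $C$) and $\mathsf P_C$ is Euclidean projection onto $C$. Function class. Given $L,\Delta_\Phi,D_{\mathcal Y}>0$, $\mathcal F_{\rm NCC}(L,\Delta_\Phi,D_{\mathcal Y})$ is the class of continuously differentiable functions $f:\mathcal X\times\mathcal Y\to\mathbb R$, over all finite dimensions $d_x,d_y$, where $\mathcal X\subset\mathbb R^{d_x}$, $\mathcal Y\subset\mathbb R^{d_y}$ are nonempty closed convex sets with $0\in\mathcal X$, $0\in\mathcal Y$, such that: (1) $\|\nabla f(x,y)-\nabla f(x',y')\|\le L\|(x,y)-(x',y')\|$ for all $(x,y),(x',y')\in\mathcal X\times\mathcal Y$ (joint gradient); (2) $f(x,\cdot)$ is concave on $\mathcal Y$ for every $x\in\mathcal X$; (3) $\operatorname{diam}(\mathcal Y):=\sup_{y,y'\in\mathcal Y}\|y-y'\|\le D_{\mathcal Y}$; (4) with $\Phi_f(x):=\max_{y\in\mathcal Y}f(x,y)$, $\Phi_f(0)-\inf_{x\in\mathcal X}\Phi_f(x)\le\Delta_\Phi$. Stationarity. Let $\varphi_f:=\Phi_f+\iota_{\mathcal X}$ on $\mathbb R^{d_x}$. For $\lambda>0$ put $\mathcal P_\lambda(x):=\arg\min_{p\in\mathcal X}\{\Phi_f(p)+\frac1{2\lambda}\|p-x\|^2\}$ and $G_\lambda(x;p):=\lambda^{-1}(x-p)$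 for $p\in\mathcal P_\lambda(x)$. The Moreau envelope is $(\varphi_f)_\lambda(x):=\min_{p\in\mathbb R^{d_x}}\{\varphi_f(p)+\frac1{2\lambda}\|p-x\|^2\}$. Since $\varphi_f$ is $L$-weakly convex, for $0<\lambda<1/L$ the set $\mathcal P_\lambda(x)$ is a singleton $\{p_\lambda(x)\}$, the envelope is continuously differentiable, and $\nabla(\varphi_f)_\lambda(x)=G_\lambda(x;p_\lambda(x))$. A point $x\in\mathcal X$ is $\epsilon$-stationary if $\|\nabla(\varphi_f)_{1/(2L)}(x)\|\le\epsilon$. Oracle and algorithms. The (joint) deterministic first-order oracle returns $(f(x,y),\nabla_xf(x,y),\nabla_yf(x,y))$ at a query $(x,y)\in\mathcal X\times\mathcal Y$. A deterministic zero-respecting first-order algorithm starts at $(x^0,y^0)=(0,0)$, queries the oracle at $(x^0,y^0),(x^1,y^1),\dots$, and chooses each new iterate from the previous oracle responses so that $x^{t+1}=\mathsf P_{\mathcal X}(u)$ for some $u$ with $\operatorname{supp}(u)\subseteq\bigcup_{0\le i\le t}(\operatorname{supp}(x^i)\cup\operatorname{supp}(\nabla_xf(x^i,y^i)))$ and $y^{t+1}=\mathsf P_{\mathcal Y}(v)$ for some $v$ with $\operatorname{supp}(v)\subseteq\bigcup_{0\le i\le t}(\operatorname{supp}(y^i)\cup\operatorname{supp}(\nabla_yf(x^i,y^i)))$. The primal output after $q$ oracle calls (at $(x^0,y^0),\dots,(x^{q-1},y^{q-1})$) is required to satisfy the same zero-respecting condition as a primal iterate: it equals $\mathsf P_{\mathcal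 X}(u)$ with $\operatorname{supp}(u)\subseteq\bigcup_{0\le i\le q-1}(\operatorname{supp}(x^i)\cup\operatorname{supp}(\nabla_xf(x^i,y^i)))$. "Universal constant" means a numerical constant independent of all problem parameters and dimensions. *)

theory Defs
  imports "HOL-Analysis.Analysis"
begin

text \<open>
  The dimensions of an instance depend on the problem parameters, so they cannot be types here.
  All Euclidean spaces are realised inside one inner product space: the finitely supported real
  sequences with the standard inner product. The space \<open>\<real>\<^sup>d\<close> is the coordinate subspace
  \<open>euclid d\<close> of sequences vanishing from index \<open>d\<close> on, with the induced (Euclidean) norm and
  topology; it is closed, so a subset of it is closed in \<open>\<real>\<^sup>d\<close> iff it is closed in the big space.
\<close>

typedef fvec = "{v :: nat \<Rightarrow> real. finite {i. v i \<noteq> 0}}"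
  morphisms coord Abs_fvec
  by (rule exI[of _ "\<lambda>_. 0"]) simp

setup_lifting type_definition_fvec

lemma fvec_eqI: "(\<And>i. coord v i = coord w i) \<Longrightarrow> v = w"
  by (metis coord_inject ext)

definition supp :: "fvec \<Rightarrow> nat set" where
  "supp v = {i. coord v i \<noteq> 0}"

lemma finite_supp [simp]: "finite (supp v)"
  using coord[of v] by (simp add: supp_def)

instantiation fvec :: real_vector
begin

lift_definition zero_fvec :: fvec is "\<lambda>_. 0" by simp

lift_definition plus_fvec :: "fvec \<Rightarrow> fvec \<Rightarrow> fvec" is "\<lambda>v w i. v i + w i"
  subgoal for v w by (rule finite_subset[of _ "{i. v i \<noteq> 0} \<union> {i. w i \<noteq> 0}"]) auto
  done

lift_definition uminus_fvec :: "fvec \<Rightarrow> fvec" is "\<lambda>v i. - v i" by simp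

lift_definition minus_fvec :: "fvec \<Rightarrow> fvec \<Rightarrow> fvec" is "\<lambda>v w i. v i - w i"
  subgoal for v w by (rule finite_subset[of _ "{i. v i \<noteq> 0} \<union> {i. w i \<noteq> 0}"]) auto
  done

lift_definition scaleR_fvec :: "real \<Rightarrow> fvec \<Rightarrow> fvec" is "\<lambda>c v i. c * v i"
  by (rule finite_subset) auto

instance
  by standard (transfer; simp add: algebra_simps)+

end

lemmas coord_simps [simp] =
  zero_fvec.rep_eq plus_fvec.rep_eq uminus_fvec.rep_eq minus_fvec.rep_eq scaleR_fvec.rep_eq

instantiation fvec :: real_inner
begin

definition inner_fvec :: "fvec \<Rightarrow> fvec \<Rightarrow> real" where
  "inner_fvec v w = (\<Sum>i\<in>supp v. coord v i * coord w i)"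

definition norm_fvec :: "fvec \<Rightarrow> real" where
  "norm_fvec v = sqrt (inner v v)"

definition dist_fvec :: "fvec \<Rightarrow> fvec \<Rightarrow> real" where
  "dist_fvec v w = norm (v - w)"

definition sgn_fvec :: "fvec \<Rightarrow> fvec" where
  "sgn_fvec v = inverse (norm v) *\<^sub>R v"

definition uniformity_fvec :: "(fvec \<times> fvec) filter" where
  "uniformity_fvec = (INF e\<in>{0<..}. principal {(v, w). dist v w < e})"

definition open_fvec :: "fvec set \<Rightarrow> bool" where
  "open_fvec U = (\<forall>v\<in>U. eventually (\<lambda>(v', w). v' = v \<longrightarrow> w \<in> U) uniformity)"

lemma inner_fvec_superset:
  assumes "finite S" "supp v \<subseteq> S"
  shows "inner v w = (\<Sum>i\<in>S. coord v i * coord w i)"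
  unfolding inner_fvec_def using assms
  by (intro sum.mono_neutral_left) (auto simp: supp_def)

instance
proof
  fix u v w :: fvec and c :: real
  define S where "S = supp u \<union> supp v \<union> supp (u + v)"
  have S: "finite S" "supp u \<subseteq> S" "supp v \<subseteq> S" "supp (u + v) \<subseteq> S"
    by (auto simp: S_def)
  show "dist u v = norm (u - v)" by (rule dist_fvec_def)
  show "sgn u = inverse (norm u) *\<^sub>R u" by (rule sgn_fvec_def)
  show "uniformity = (INF e\<in>{0<..}. principal {(v :: fvec, w). dist v w < e})"
    by (rule uniformity_fvec_def)
  show "open U \<longleftrightarrow> (\<forall>v\<in>U. eventually (\<lambda>(v', w). v' = v \<longrightarrow> w \<in> U) uniformity)"
    for U :: "fvec set" by (rule open_fvec_def)
  show "inner u v = inner v u"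
    using S by (simp add: inner_fvec_superset[of S] mult.commute)
  show "inner (u + v) w = inner u w + inner v w"
    using S by (simp add: inner_fvec_superset[of S] algebra_simps sum.distrib)
  have "supp (c *\<^sub>R u) \<subseteq> S" using S by (auto simp: supp_def)
  then show "inner (c *\<^sub>R u) v = c * inner u v"
    using S by (simp add: inner_fvec_superset[of S] sum_distrib_left mult.assoc)
  show "0 \<le> inner u u" by (simp add: inner_fvec_def sum_nonneg)
  show "inner u u = 0 \<longleftrightarrow> u = 0"
  proof
    assume "inner u u = 0"
    then have "\<forall>i\<in>supp u. coord u i * coord u i = 0"
      by (simp add: inner_fvec_def sum_nonneg_eq_0_iff)
    then have "coord u i = 0" for i by (auto simp: supp_def)
    then show "u = 0" by (intro fvec_eqI) simp
  qed (simp add: inner_fvec_def)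
  show "norm u = sqrt (inner u u)" by (rule norm_fvec_def)
qed

end

definition euclid :: "nat \<Rightarrow> fvec set" where
  "euclid d = {v. supp v \<subseteq> {..<d}}"

text \<open>
  \<open>is_gradient_on E F z g\<close>: \<open>g\<close> is the gradient at \<open>z\<close> of \<open>F\<close> regarded as a function on the
  linear subspace \<open>E\<close>. Such a \<open>g\<close> is unique (see below), so the definite description is harmless.
\<close>

definition is_gradient_on :: "'a::real_inner set \<Rightarrow> ('a \<Rightarrow> real) \<Rightarrow> 'a \<Rightarrow> 'a \<Rightarrow> bool" where
  "is_gradient_on E F z g \<longleftrightarrow> g \<in> E \<and> (F has_derivative (\<lambda>h. inner g h)) (at z within E)"

definition gradient_on :: "'a::real_inner set \<Rightarrow> ('a \<Rightarrow> real) \<Rightarrow> 'a \<Rightarrow> 'a" where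
  "gradient_on E F z = (THE g. is_gradient_on E F z g)"

lemma is_gradient_on_unique:
  assumes E: "subspace E" "z \<in> E" and g: "is_gradient_on E F z g" and g': "is_gradient_on E F z g'"
  shows "g = g'"
proof (rule ccontr)
  assume ne: "g \<noteq> g'"
  let ?k = "g - g'"
  have k: "?k \<in> E" using E g g' by (auto simp: is_gradient_on_def subspace_diff)
  have *: "((\<lambda>t. F (z + t *\<^sub>R ?k)) has_derivative (\<lambda>t. inner a (t *\<^sub>R ?k))) (at 0)"
    if "is_gradient_on E F z a" for a
  proof -
    have "range (\<lambda>t::real. z + t *\<^sub>R ?k) \<subseteq> E"
      using E k by (auto intro: subspace_add subspace_scale)
    then have "(F has_derivative inner a) (at (z + 0 *\<^sub>R ?k) within range (\<lambda>t::real. z + t *\<^sub>R ?k))"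
      using that by (auto simp: is_gradient_on_def intro: has_derivative_subset)
    moreover have "((\<lambda>t::real. z + t *\<^sub>R ?k) has_derivative (\<lambda>t. t *\<^sub>R ?k)) (at 0)"
      by (auto intro!: derivative_eq_intros)
    ultimately show ?thesis
      using has_derivative_in_compose[of "\<lambda>t::real. z + t *\<^sub>R ?k" "\<lambda>t. t *\<^sub>R ?k" 0 UNIV F "inner a"]
      by simp
  qed
  have "(\<lambda>t. inner g (t *\<^sub>R ?k)) = (\<lambda>t. inner g' (t *\<^sub>R ?k))"
    by (rule has_derivative_unique[OF *[OF g] *[OF g']])
  then have "inner g (1 *\<^sub>R ?k) = inner g' (1 *\<^sub>R ?k)" by (rule fun_cong)
  then have "inner ?k ?k = 0" by (simp add: inner_diff_left)
  with ne show False by simp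
qed

definition proj :: "fvec set \<Rightarrow> fvec \<Rightarrow> fvec" where
  "proj C u = arg_min_on (\<lambda>p. norm (p - u)) C"

definition convex_indicator :: "'a set \<Rightarrow> 'a \<Rightarrow> ereal" where
  "convex_indicator C x = (if x \<in> C then 0 else \<infinity>)"

record inst =
  dimx :: nat
  dimy :: nat
  setX :: "fvec set"
  setY :: "fvec set"
  objective :: "fvec \<times> fvec \<Rightarrow> real"

abbreviation amb :: "inst \<Rightarrow> (fvec \<times> fvec) set" where
  "amb I \<equiv> euclid (dimx I) \<times> euclid (dimy I)"

definition grad :: "inst \<Rightarrow> fvec \<times> fvec \<Rightarrow> fvec \<times> fvec" where
  "grad I z = gradient_on (amb I) (objective I) z"

definition gradx :: "inst \<Rightarrow> fvec \<times> fvec \<Rightarrow> fvec" where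
  "gradx I z = fst (grad I z)"

definition grady :: "inst \<Rightarrow> fvec \<times> fvec \<Rightarrow> fvec" where
  "grady I z = snd (grad I z)"

(* For instances of the class below the supremum is a maximum, since setY is compact. *)
definition primal :: "inst \<Rightarrow> fvec \<Rightarrow> real" where
  "primal I x = (SUP y\<in>setY I. objective I (x, y))"

text \<open>
  Since \<open>setX I\<close> and \<open>setY I\<close> may have empty interior, differentiability at the points of their
  product is understood in the ambient space \<open>\<real>\<^bsup>dx\<^esup> \<times> \<real>\<^bsup>dy\<^esup>\<close>, which makes the gradient unique.
  By Whitney extension this is no restriction: a function on a closed convex set that has there a
  Lipschitz gradient field extends differentiably to the whole space with the same gradients.
  Boundedness is stated separately because \<open>diameter\<close> and real infima are only
  meaningful for bounded sets.
\<close>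

definition NCC :: "real \<Rightarrow> real \<Rightarrow> real \<Rightarrow> inst set" where
  "NCC L \<Delta> D = {I.
     setX I \<subseteq> euclid (dimx I) \<and> closed (setX I) \<and> convex (setX I) \<and> 0 \<in> setX I \<and>
     setY I \<subseteq> euclid (dimy I) \<and> closed (setY I) \<and> convex (setY I) \<and> 0 \<in> setY I \<and>
     (\<forall>z \<in> setX I \<times> setY I. objective I differentiable (at z within amb I)) \<and>
     continuous_on (setX I \<times> setY I) (grad I) \<and>
     (\<forall>z \<in> setX I \<times> setY I. \<forall>z' \<in> setX I \<times> setY I.
        norm (grad I z - grad I z') \<le> L * norm (z - z')) \<and>
     (\<forall>x \<in> setX I. concave_on (setY I) (\<lambda>y. objective I (x, y))) \<and>
     bounded (setY I) \<and> diameter (setY I) \<le> D \<and>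
     bdd_below (primal I ` setX I) \<and> primal I 0 - (INF x\<in>setX I. primal I x) \<le> \<Delta>}"

definition primal_ext :: "inst \<Rightarrow> fvec \<Rightarrow> ereal" where
  "primal_ext I x = ereal (primal I x) + convex_indicator (setX I) x"

definition prox_set :: "inst \<Rightarrow> real \<Rightarrow> fvec \<Rightarrow> fvec set" where
  "prox_set I lam x =
     {p. is_arg_min (\<lambda>p. primal I p + 1 / (2 * lam) * (norm (p - x))\<^sup>2) (\<lambda>p. p \<in> setX I) p}"

definition grad_map :: "real \<Rightarrow> fvec \<Rightarrow> fvec \<Rightarrow> fvec" where
  "grad_map lam x p = (1 / lam) *\<^sub>R (x - p)"

definition moreau :: "inst \<Rightarrow> real \<Rightarrow> fvec \<Rightarrow> real" where
  "moreau I lam x = real_of_ereal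
     (INF p\<in>euclid (dimx I). primal_ext I p + ereal (1 / (2 * lam) * (norm (p - x))\<^sup>2))"

definition moreau_grad :: "inst \<Rightarrow> real \<Rightarrow> fvec \<Rightarrow> fvec" where
  "moreau_grad I lam x = gradient_on (euclid (dimx I)) (moreau I lam) x"

definition eps_stationary :: "real \<Rightarrow> inst \<Rightarrow> real \<Rightarrow> fvec \<Rightarrow> bool" where
  "eps_stationary L I \<epsilon> x \<longleftrightarrow> x \<in> setX I \<and> norm (moreau_grad I (1 / (2 * L)) x) \<le> \<epsilon>"

type_synonym response = "real \<times> fvec \<times> fvec"

definition oracle_response :: "inst \<Rightarrow> fvec \<times> fvec \<Rightarrow> response" where
  "oracle_response I z = (objective I z, gradx I z, grady I z)"

text \<open>
  A deterministic algorithm knows the dimensions and the feasible sets, but learns about the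
  objective only through the list of oracle responses received so far; from these it computes its
  next query and the primal output it would return if it stopped.
\<close>

type_synonym domain = "nat \<times> nat \<times> fvec set \<times> fvec set"

record algorithm =
  next_query :: "domain \<Rightarrow> response list \<Rightarrow> fvec \<times> fvec"
  primal_output :: "domain \<Rightarrow> response list \<Rightarrow> fvec"

definition dom_of :: "inst \<Rightarrow> domain" where
  "dom_of I = (dimx I, dimy I, setX I, setY I)"

primrec responses :: "algorithm \<Rightarrow> inst \<Rightarrow> nat \<Rightarrow> response list" where
  "responses A I 0 = []"
| "responses A I (Suc t) =
     responses A I t @ [oracle_response I (next_query A (dom_of I) (responses A I t))]"

definition iterate :: "algorithm \<Rightarrow> inst \<Rightarrow> nat \<Rightarrow> fvec \<times> fvec" where
  "iterate A I t = next_query A (dom_of I) (responses A I t)"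

(* The points reachable after q oracle calls, that is, queries 0, ..., q - 1. *)
definition zr_primal :: "algorithm \<Rightarrow> inst \<Rightarrow> nat \<Rightarrow> fvec \<Rightarrow> bool" where
  "zr_primal A I q x \<longleftrightarrow>
     (\<exists>u. supp u \<subseteq> (\<Union>i<q. supp (fst (iterate A I i)) \<union> supp (gradx I (iterate A I i))) \<and>
          x = proj (setX I) u)"

definition zr_dual :: "algorithm \<Rightarrow> inst \<Rightarrow> nat \<Rightarrow> fvec \<Rightarrow> bool" where
  "zr_dual A I q y \<longleftrightarrow>
     (\<exists>v. supp v \<subseteq> (\<Union>i<q. supp (snd (iterate A I i)) \<union> supp (grady I (iterate A I i))) \<and>
          y = proj (setY I) v)"

definition zero_respecting_on :: "algorithm \<Rightarrow> inst \<Rightarrow> bool" where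
  "zero_respecting_on A I \<longleftrightarrow>
     iterate A I 0 = (0, 0) \<and>
     (\<forall>t. zr_primal A I (Suc t) (fst (iterate A I (Suc t))) \<and>
          zr_dual A I (Suc t) (snd (iterate A I (Suc t))))"

definition output_after :: "algorithm \<Rightarrow> inst \<Rightarrow> nat \<Rightarrow> fvec" where
  "output_after A I q = primal_output A (dom_of I) (responses A I q)"

definition zr_algorithms :: "inst set \<Rightarrow> algorithm set" where
  "zr_algorithms \<F> =
     {A. \<forall>I\<in>\<F>. zero_respecting_on A I \<and> (\<forall>q. zr_primal A I q (output_after A I q))}"

definition calls_needed :: "real \<Rightarrow> real \<Rightarrow> algorithm \<Rightarrow> inst \<Rightarrow> enat" where
  "calls_needed L \<epsilon> A I = (INF q\<in>{q. eps_stationary L I \<epsilon> (output_after A I q)}. enat q)"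

(* Minimax over algorithms and instances; infinite if no algorithm has a uniform bound. *)
definition oracle_complexity :: "real \<Rightarrow> real \<Rightarrow> real \<Rightarrow> real \<Rightarrow> enat" where
  "oracle_complexity L \<Delta> D \<epsilon> =
     (INF A\<in>zr_algorithms (NCC L \<Delta> D). SUP I\<in>NCC L \<Delta> D. calls_needed L \<epsilon> A I)"

end

theory Submission
  imports Defs
begin

text \<open>
  The hard instance is a chain of \<open>N + 1\<close> blocks with \<open>2 * n\<close> primal coordinates each, where \<open>n\<close> is of
  order \<open>L * D / \<epsilon>\<close> and \<open>N\<close> of order \<open>L * \<Delta> / \<epsilon>\<^sup>2\<close>. Its objective is
  \<open>(\<Sum>j. y\<^sub>j * \<kappa> * (drive j - x\<^sub>j)) + pot x\<close> with \<open>y\<^sub>j \<ge> 0\<close>, so the maximum over \<open>y\<close> penalises every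
  coordinate that lies below its drive. Inside a block the drive is the preceding coordinate. The
  drive of the first coordinate of a block is an average of switches on the second half (the
  sensors) of the preceding block; it takes its full value \<open>a\<close> once all sensors have reached
  \<open>3 * a\<close>. The very first drive is the constant \<open>a\<close>. The potential decreases in each coordinate
  between \<open>0\<close> and \<open>4 * a\<close> and is flat elsewhere.

  \<^emph>\<open>Slow revelation.\<close> At the origin every partial derivative vanishes except the one along the first
  dual coordinate. A derivative becomes nonzero only after its predecessor in the chain has become
  nonzero, and a block is entered only through a sensor of the preceding block. Hence a block is
  entered at least \<open>n\<close> oracle calls later than its predecessor (\<open>supp_iterate\<close>), and after at most
  \<open>n * N\<close> calls the last block is still zero.

  \<^emph>\<open>Near-stationary points have a completed chain.\<close> The proximal point \<open>p\<close> of \<open>x\<close> is the primal half of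
  a saddle point \<open>(p, y)\<close> (\<open>proximal_saddle_point\<close>), and the gradient mapping is the partial gradient
  of the objective at \<open>(p, y)\<close>. Suppose its norm is at most \<open>\<epsilon>\<close>. In each block the gradient controls
  the decrements of \<open>y\<close>, which vanishes behind the end of the block, so a discrete Hardy inequality
  makes \<open>y\<close> too small for any upper constraint of the dual set to bind. As \<open>y\<close> is optimal, no
  coordinate of \<open>p\<close> lies below its drive. If the first drive of a block is \<open>a\<close>, then all coordinates
  of that block are therefore at least \<open>a\<close>, and they are nondecreasing. Between \<open>a\<close> and \<open>3 * a\<close> the
  slope of the potential forbids more than \<open>n\<close> coordinates, so all sensors have reached \<open>3 * a\<close> and
  the next block is driven, too (\<open>near_stationary_completed\<close>). Thus the last block of \<open>p\<close> is large,
  although it vanishes for \<open>x\<close>, and \<open>p\<close> is too far from \<open>x\<close> for a small gradient mapping.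

  \<^emph>\<open>Budgets.\<close> A coordinate moves by the order of \<open>\<epsilon> / (L * sqrt n)\<close> and gains the order of
  \<open>\<epsilon>\<^sup>2 / (L * n)\<close>, hence the primal gap is of order \<open>N * \<epsilon>\<^sup>2 / L\<close>. The linear dependence on the diameter comes from
  imposing one Euclidean ball of radius \<open>D / 2\<close> on the dual variables of all blocks together: the
  Hardy inequality bounds the norm of the whole \<open>y\<close> by the order of \<open>n * \<epsilon> / L\<close>, independently of
  the number of blocks.
\<close>

section \<open>Coordinate geometry\<close>

definition mk_vec :: "nat \<Rightarrow> (nat \<Rightarrow> real) \<Rightarrow> fvec" where
  "mk_vec d f = Abs_fvec (\<lambda>i. if i < d then f i else 0)"

lemma coord_mk_vec [simp]: "coord (mk_vec d f) i = (if i < d then f i else 0)"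
proof -
  have "{i. (if i < d then f i else 0) \<noteq> 0} \<subseteq> {..<d}" by auto
  then have "finite {i. (if i < d then f i else 0) \<noteq> 0}"
    by (rule finite_subset) simp
  then show ?thesis by (simp add: mk_vec_def Abs_fvec_inverse)
qed

lemma mem_euclid: "v \<in> euclid d \<longleftrightarrow> (\<forall>i\<ge>d. coord v i = 0)"
  unfolding euclid_def supp_def by (auto simp: subset_iff) (metis not_less)

lemma mk_vec_in_euclid [simp]: "mk_vec d f \<in> euclid d"
  by (simp add: mem_euclid)

lemma subspace_euclid: "subspace (euclid d)"
  by (auto simp: subspace_def mem_euclid)

lemma zero_in_euclid [simp]: "0 \<in> euclid d"
  by (rule subspace_0[OF subspace_euclid])

lemma inner_euclid: "v \<in> euclid d \<Longrightarrow> inner v w = (\<Sum>i<d. coord v i * coord w i)"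
  by (rule inner_fvec_superset) (auto simp: euclid_def)

lemma inner_mk_vec: "inner (mk_vec d f) w = (\<Sum>i<d. f i * coord w i)"
  by (simp add: inner_euclid[of _ d])

lemma norm_euclid: "v \<in> euclid d \<Longrightarrow> (norm v)\<^sup>2 = (\<Sum>i<d. (coord v i)\<^sup>2)"
  unfolding power2_norm_eq_inner by (simp add: inner_euclid[of _ d] power2_eq_square)

lemma coord_eq_inner: "coord v i = inner (mk_vec (Suc i) (\<lambda>k. if k = i then 1 else 0)) v"
  by (simp add: inner_mk_vec)

lemma bounded_linear_coord: "bounded_linear (\<lambda>v. coord v i)"
  unfolding coord_eq_inner by (rule bounded_linear_inner_right)

lemma coord_le_norm: "\<bar>coord v i\<bar> \<le> norm v"
proof -
  let ?e = "mk_vec (Suc i) (\<lambda>k. if k = i then 1 else 0)"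
  have "inner ?e ?e = (\<Sum>k<Suc i. if k = i then 1 else 0)"
    unfolding inner_mk_vec by (rule sum.cong) auto
  then have "norm ?e = 1" by (simp add: norm_eq_sqrt_inner)
  then show ?thesis
    using Cauchy_Schwarz_ineq2[of ?e v] by (simp add: coord_eq_inner)
qed

lemmas coord_continuous [continuous_intros] = bounded_linear.continuous_on[OF bounded_linear_coord]
lemmas coord_has_derivative [derivative_intros] = bounded_linear.has_derivative[OF bounded_linear_coord]

lemma closed_euclid: "closed (euclid d)"
proof -
  have "euclid d = (\<Inter>i\<in>{d..}. {v. coord v i = 0})"
    by (auto simp: mem_euclid)
  moreover have "closed {v. coord v i = 0}" for i
    by (intro closed_Collect_eq continuous_intros)
  ultimately show ?thesis by auto
qed

text \<open>
  The space of all finitely supported sequences is not locally compact, so compactness has to be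
  obtained inside one coordinate subspace; a cube is a product of intervals, built up one
  coordinate at a time.
\<close>

lemma compact_cube: "compact {v \<in> euclid d. \<forall>i. \<bar>coord v i\<bar> \<le> B}"
proof (induction d)
  case 0
  have "{v \<in> euclid 0. \<forall>i. \<bar>coord v i\<bar> \<le> B} \<subseteq> {0}"
    by (auto simp: mem_euclid intro: fvec_eqI)
  then have "finite {v \<in> euclid 0. \<forall>i. \<bar>coord v i\<bar> \<le> B}"
    by (rule finite_subset) simp
  then show ?case by (rule finite_imp_compact)
next
  case (Suc d)
  let ?Q = "\<lambda>d. {v \<in> euclid d. \<forall>i. \<bar>coord v i\<bar> \<le> B}"
  let ?e = "mk_vec (Suc d) (\<lambda>k. if k = d then 1 else 0)"
  have "?Q (Suc d) = (\<lambda>(v, t). v + t *\<^sub>R ?e) ` (?Q d \<times> {-B..B})"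
  proof (intro equalityI subsetI)
    fix v assume v: "v \<in> ?Q (Suc d)"
    have beyond: "coord v i = 0" if "i > d" for i using v that by (simp add: mem_euclid)
    have eq: "v = mk_vec d (coord v) + coord v d *\<^sub>R ?e"
    proof (rule fvec_eqI)
      fix i
      show "coord v i = coord (mk_vec d (coord v) + coord v d *\<^sub>R ?e) i"
        using beyond[of i] by (cases i d rule: linorder_cases) simp_all
    qed
    have bd: "\<bar>coord v i\<bar> \<le> B" for i using v by auto
    then have "0 \<le> B" using order.trans abs_ge_zero by blast
    then have "mk_vec d (coord v) \<in> ?Q d" using bd by simp
    moreover have "coord v d \<in> {-B..B}" using bd[of d] by (simp add: abs_le_iff)
    ultimately have "(mk_vec d (coord v), coord v d) \<in> ?Q d \<times> {-B..B}" by blast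
    then show "v \<in> (\<lambda>(v, t). v + t *\<^sub>R ?e) ` (?Q d \<times> {-B..B})"
      using eq by (intro image_eqI[where x = "(mk_vec d (coord v), coord v d)"]) simp_all
  next
    fix v assume "v \<in> (\<lambda>(v, t). v + t *\<^sub>R ?e) ` (?Q d \<times> {-B..B})"
    then obtain z where z: "z \<in> ?Q d \<times> {-B..B}" "v = (\<lambda>(v, t). v + t *\<^sub>R ?e) z"
      by (rule imageE)
    define v' where "v' = fst z"
    define t where "t = snd z"
    have v': "v' \<in> ?Q d" "\<bar>t\<bar> \<le> B" "v = v' + t *\<^sub>R ?e"
      using z by (simp_all add: v'_def t_def mem_Times_iff case_prod_beta abs_le_iff)
    then have "coord v' d = 0" by (simp add: mem_euclid)
    then have "coord v i = (if i = d then t else coord v' i)" for i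
      unfolding v'(3) by simp
    then show "v \<in> ?Q (Suc d)"
      using v' by (simp add: mem_euclid)
  qed
  then show ?case
    using Suc by (auto intro!: compact_continuous_image compact_Times continuous_intros
        simp: case_prod_beta)
qed

lemma compact_euclid:
  assumes "closed S" "S \<subseteq> euclid d" "bounded S"
  shows "compact S"
proof -
  obtain B where B: "\<And>v. v \<in> S \<Longrightarrow> norm v \<le> B" using \<open>bounded S\<close> by (auto simp: bounded_iff)
  have eq: "{v \<in> euclid d. \<forall>i. \<bar>coord v i\<bar> \<le> B} \<inter> S = S"
    using assms(2) B coord_le_norm order.trans by blast
  have "compact ({v \<in> euclid d. \<forall>i. \<bar>coord v i\<bar> \<le> B} \<inter> S)"
    by (rule compact_Int_closed[OF compact_cube \<open>closed S\<close>])
  then show ?thesis by (simp only: eq)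
qed

lemma proj_minimizes:
  assumes "compact C" "C \<noteq> {}"
  shows "proj C u \<in> C" and "\<And>p. p \<in> C \<Longrightarrow> norm (proj C u - u) \<le> norm (p - u)"
proof -
  obtain p0 where "p0 \<in> C" "\<forall>p\<in>C. norm (p0 - u) \<le> norm (p - u)"
    using continuous_attains_inf[OF assms continuous_on_norm[OF continuous_on_diff
        [OF continuous_on_id continuous_on_const]], of u] by auto
  then have "is_arg_min (\<lambda>p. norm (p - u)) (\<lambda>p. p \<in> C) p0"
    by (auto simp: is_arg_min_linorder)
  then have "is_arg_min (\<lambda>p. norm (p - u)) (\<lambda>p. p \<in> C) (proj C u)"
    unfolding proj_def arg_min_on_def arg_min_def by (rule someI)
  then show "proj C u \<in> C" "\<And>p. p \<in> C \<Longrightarrow> norm (proj C u - u) \<le> norm (p - u)"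
    by (auto simp: is_arg_min_linorder)
qed

lemma proj_self:
  assumes "u \<in> C" shows "proj C u = u"
proof -
  have "is_arg_min (\<lambda>p. norm (p - u)) (\<lambda>p. p \<in> C) u"
    using assms by (auto simp: is_arg_min_linorder)
  then have "is_arg_min (\<lambda>p. norm (p - u)) (\<lambda>p. p \<in> C) (proj C u)"
    unfolding proj_def arg_min_on_def arg_min_def by (rule someI)
  then have "norm (proj C u - u) \<le> norm (u - u)" using assms by (auto simp: is_arg_min_linorder)
  then show ?thesis by simp
qed

text \<open>
  Projecting onto a set that is stable under deleting coordinates creates no new nonzero
  coordinate: deleting a coordinate outside the support of the projected point would bring the
  projection strictly closer.
\<close>

lemma supp_proj_subset:
  assumes C: "compact C" "C \<noteq> {}" "C \<subseteq> euclid d"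
    and del: "\<And>v S. v \<in> C \<Longrightarrow> mk_vec d (\<lambda>i. if i \<in> S then coord v i else 0) \<in> C"
    and u: "u \<in> euclid d"
  shows "supp (proj C u) \<subseteq> supp u"
proof
  fix k assume k: "k \<in> supp (proj C u)"
  let ?p = "proj C u" and ?v = "mk_vec d (\<lambda>i. if i \<in> supp u then coord (proj C u) i else 0)"
  have p: "?p \<in> C" by (rule proj_minimizes[OF C(1,2)])
  show "k \<in> supp u"
  proof (rule ccontr)
    assume ku: "k \<notin> supp u"
    have kd: "k < d" using k p C(3) by (auto simp: euclid_def)
    have "(norm (?v - u))\<^sup>2 = (\<Sum>i<d. (coord (?v - u) i)\<^sup>2)"
      by (intro norm_euclid subspace_diff[OF subspace_euclid] u) simp
    also have "\<dots> < (\<Sum>i<d. (coord (?p - u) i)\<^sup>2)"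
    proof (rule sum_strict_mono_ex1)
      show "\<forall>i\<in>{..<d}. (coord (?v - u) i)\<^sup>2 \<le> (coord (?p - u) i)\<^sup>2"
        by (auto simp: supp_def)
      show "\<exists>i\<in>{..<d}. (coord (?v - u) i)\<^sup>2 < (coord (?p - u) i)\<^sup>2"
        using kd k ku by (intro bexI[of _ k]) (auto simp: supp_def)
    qed simp
    also have "\<dots> = (norm (?p - u))\<^sup>2"
      using p C(3) u by (intro norm_euclid[symmetric] subspace_diff[OF subspace_euclid]) auto
    finally have "norm (?v - u) < norm (?p - u)" by (simp add: power_less_imp_less_base)
    moreover have "?v \<in> C" by (rule del[OF p])
    ultimately show False using proj_minimizes(2)[OF C(1,2), of ?v u] by simp
  qed
qed

section \<open>Proximal points as saddle points\<close>

lemma has_derivative_quadratic_remainder: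
  fixes F :: "'a::real_normed_vector \<Rightarrow> real"
  assumes f': "bounded_linear f'"
    and rem: "\<And>y. y \<in> S \<Longrightarrow> \<bar>F y - F x - f' (y - x)\<bar> \<le> K * (norm (y - x))\<^sup>2"
  shows "(F has_derivative f') (at x within S)"
  unfolding has_derivative_within_alt
proof (intro conjI allI impI f')
  fix e :: real assume e: "e > 0"
  have "norm (F y - F x - f' (y - x)) \<le> e * norm (y - x)"
    if y: "y \<in> S" and d: "norm (y - x) < e / (\<bar>K\<bar> + 1)" for y
  proof -
    have "K * norm (y - x) \<le> (\<bar>K\<bar> + 1) * norm (y - x)"
      by (intro mult_right_mono) auto
    also have "\<dots> \<le> e" using d by (simp add: field_simps)
    finally have "K * norm (y - x) * norm (y - x) \<le> e * norm (y - x)"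
      by (intro mult_right_mono) auto
    with rem[OF y] show ?thesis by (simp add: power2_eq_square mult.assoc)
  qed
  then show "\<exists>d>0. \<forall>y\<in>S. norm (y - x) < d \<longrightarrow> norm (F y - F x - f' (y - x)) \<le> e * norm (y - x)"
    using e by (intro exI[of _ "e / (\<bar>K\<bar> + 1)"]) (auto simp: add_nonneg_pos)
qed

text \<open>
  Along the segment from \<open>x\<close> to \<open>x'\<close> the function minus its quadratic upper model has a nonpositive
  derivative. The two-sided estimate follows by applying this to \<open>- F\<close> as well.
\<close>

lemma lipschitz_gradient_upper:
  fixes F :: "'a::real_inner \<Rightarrow> real"
  assumes E: "convex E" "x \<in> E" "x' \<in> E"
    and der: "\<And>z. z \<in> E \<Longrightarrow> (F has_derivative (\<lambda>h. inner (g z) h)) (at z)"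
    and lip: "\<And>z z'. z \<in> E \<Longrightarrow> z' \<in> E \<Longrightarrow> norm (g z - g z') \<le> L * norm (z - z')"
  shows "F x' - F x - inner (g x) (x' - x) \<le> L / 2 * (norm (x' - x))\<^sup>2"
proof -
  define v where "v = x' - x"
  define \<phi> where "\<phi> = (\<lambda>t. F (x + t *\<^sub>R v) - t * inner (g x) v - L / 2 * t\<^sup>2 * (norm v)\<^sup>2)"
  have in_E: "x + t *\<^sub>R v \<in> E" if "0 \<le> t" "t \<le> 1" for t
  proof -
    have "x + t *\<^sub>R v = (1 - t) *\<^sub>R x + t *\<^sub>R x'" by (simp add: v_def algebra_simps)
    then show ?thesis using E that by (auto simp: convex_alt)
  qed
  have "\<phi> 1 \<le> \<phi> 0"
  proof (rule DERIV_nonpos_imp_nonincreasing[of 0 1 \<phi>])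
    fix t :: real assume t: "0 \<le> t" "t \<le> 1"
    have "((\<lambda>t. x + t *\<^sub>R v) has_derivative (\<lambda>s. s *\<^sub>R v)) (at t)"
      by (auto intro!: derivative_eq_intros)
    from has_derivative_compose[OF this der[OF in_E[OF t]]] have "((\<lambda>t. F (x + t *\<^sub>R v)) has_real_derivative inner (g (x + t *\<^sub>R v)) v) (at t)"
      by (simp add: has_field_derivative_def mult_commute_abs)
    then have "(\<phi> has_real_derivative
        inner (g (x + t *\<^sub>R v)) v - inner (g x) v - L * t * (norm v)\<^sup>2) (at t)"
      unfolding \<phi>_def by (auto intro!: derivative_eq_intros)
    moreover have "inner (g (x + t *\<^sub>R v)) v - inner (g x) v - L * t * (norm v)\<^sup>2 \<le> 0"
    proof -
      have "inner (g (x + t *\<^sub>R v) - g x) v \<le> norm (g (x + t *\<^sub>R v) - g x) * norm v"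
        by (rule norm_cauchy_schwarz)
      also have "\<dots> \<le> L * norm (x + t *\<^sub>R v - x) * norm v"
        using lip[OF in_E[OF t] E(2)] by (intro mult_right_mono) auto
      finally show ?thesis using t by (simp add: inner_diff_left power2_eq_square mult.assoc)
    qed
    ultimately show "\<exists>y. DERIV \<phi> t :> y \<and> y \<le> 0" by blast
  qed simp
  then show ?thesis by (simp add: \<phi>_def v_def)
qed

lemma lipschitz_gradient_quadratic_remainder:
  fixes F :: "'a::real_inner \<Rightarrow> real"
  assumes E: "convex E" "x \<in> E" "x' \<in> E"
    and der: "\<And>z. z \<in> E \<Longrightarrow> (F has_derivative (\<lambda>h. inner (g z) h)) (at z)"
    and lip: "\<And>z z'. z \<in> E \<Longrightarrow> z' \<in> E \<Longrightarrow> norm (g z - g z') \<le> L * norm (z - z')"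
  shows "\<bar>F x' - F x - inner (g x) (x' - x)\<bar> \<le> L / 2 * (norm (x' - x))\<^sup>2"
proof -
  have "- F x' - (- F x) - inner (- g x) (x' - x) \<le> L / 2 * (norm (x' - x))\<^sup>2"
  proof (rule lipschitz_gradient_upper[OF E, of "\<lambda>z. - F z" "\<lambda>z. - g z"])
    show "((\<lambda>z. - F z) has_derivative inner (- g z)) (at z)" if "z \<in> E" for z
      using has_derivative_minus[OF der[OF that]] by (simp add: inner_minus_left[abs_def])
    show "norm (- g z - - g z') \<le> L * norm (z - z')" if "z \<in> E" "z' \<in> E" for z z'
      using lip[OF that(2,1)] by (simp add: norm_minus_commute)
  qed
  moreover have "F x' - F x - inner (g x) (x' - x) \<le> L / 2 * (norm (x' - x))\<^sup>2"
    by (rule lipschitz_gradient_upper[OF E der lip])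
  ultimately show ?thesis unfolding inner_minus_left by linarith
qed

text \<open>
  The quadratic lower bound makes \<open>G\<close> coercive, so a minimum over a compact ball is global. The upper
  bound forces \<open>g\<close> to vanish there, as a short step against \<open>g\<close> would otherwise decrease \<open>G\<close>.
\<close>

lemma strong_minimum_exists:
  assumes cont: "continuous_on (euclid d) G" and \<mu>: "\<mu> > 0"
    and g: "\<And>x. x \<in> euclid d \<Longrightarrow> g x \<in> euclid d"
    and lower: "\<And>x x'. x \<in> euclid d \<Longrightarrow> x' \<in> euclid d \<Longrightarrow>
      G x' \<ge> G x + inner (g x) (x' - x) + \<mu> * (norm (x' - x))\<^sup>2"
    and upper: "\<And>x x'. x \<in> euclid d \<Longrightarrow> x' \<in> euclid d \<Longrightarrow>
      G x' \<le> G x + inner (g x) (x' - x) + K * (norm (x' - x))\<^sup>2"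
  obtains p where "p \<in> euclid d" "g p = 0"
    "\<And>x. x \<in> euclid d \<Longrightarrow> G x \<ge> G p + \<mu> * (norm (x - p))\<^sup>2"
proof -
  define R where "R = norm (g 0) / \<mu>"
  have R: "R \<ge> 0" using \<mu> by (simp add: R_def)
  have "compact (euclid d \<inter> cball 0 R)"
    by (rule compact_euclid[of _ d]) (auto intro: closed_Int closed_euclid bounded_Int)
  moreover have "0 \<in> euclid d \<inter> cball 0 R" using R by simp
  ultimately obtain p where p: "p \<in> euclid d \<inter> cball 0 R"
    and pmin: "\<And>x. x \<in> euclid d \<inter> cball 0 R \<Longrightarrow> G p \<le> G x"
    using continuous_attains_inf[of "euclid d \<inter> cball 0 R" G] continuous_on_subset[OF cont]
    by (metis Int_lower1 empty_iff)
  have min: "G p \<le> G x" if x: "x \<in> euclid d" for x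
  proof (cases "norm x \<le> R")
    case True then show ?thesis using pmin x by simp
  next
    case False
    \<comment> \<open>outside the ball the quadratic term outweighs the linear one\<close>
    have "norm (g 0) * norm x \<le> \<mu> * norm x * norm x"
      using False \<mu> by (intro mult_right_mono) (auto simp: R_def field_simps)
    moreover have "- inner (g 0) x \<le> norm (g 0) * norm x"
      using Cauchy_Schwarz_ineq2[of "g 0" x] by linarith
    ultimately have "G 0 \<le> G x"
      using lower[of 0 x] x by (simp add: power2_eq_square mult.assoc)
    with pmin[of 0] R show ?thesis by simp
  qed
  have "g p = 0"
  proof (rule ccontr)
    assume "g p \<noteq> 0"
    define t where "t = 1 / (2 * (\<bar>K\<bar> + 1))"
    have t: "t > 0" "K * t \<le> 1 / 2" by (auto simp: t_def field_simps)
    have "p - t *\<^sub>R g p \<in> euclid d"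
      using p g by (intro subspace_diff subspace_scale subspace_euclid) auto
    then have "G p \<le> G p + inner (g p) (- t *\<^sub>R g p) + K * (norm (t *\<^sub>R g p))\<^sup>2"
      using min upper[of p "p - t *\<^sub>R g p"] p by fastforce
    then have "t * (norm (g p))\<^sup>2 \<le> (K * t) * (t * (norm (g p))\<^sup>2)"
      by (simp add: power2_norm_eq_inner[symmetric] power_mult_distrib power2_eq_square mult_ac)
    also have "\<dots> \<le> 1 / 2 * (t * (norm (g p))\<^sup>2)" using t by (intro mult_right_mono) auto
    finally show False using t \<open>g p \<noteq> 0\<close> by (simp add: mult_le_0_iff)
  qed
  with lower[of p] p show thesis by (intro that[of p]) auto
qed

text \<open>
  The minimax theorem in the form needed here: affine in the dual variable, strongly convex in the
  primal one. The primal minimiser \<open>P y\<close> depends Lipschitz continuously on \<open>y\<close>, so the dual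
  function attains its maximum at some \<open>y\<close>; moving from \<open>y\<close> towards \<open>y'\<close> cannot increase it, and
  since the minimiser moves only by \<open>O(t)\<close> the derivative of the payoff at the fixed point \<open>P y\<close> in
  the direction \<open>y' - y\<close> is nonpositive.
\<close>

lemma saddle_point_exists:
  fixes r :: "'a::real_inner \<Rightarrow> 'b::real_inner" and H :: "'a \<Rightarrow> real"
  assumes Y: "compact Y" "convex Y" "Y \<noteq> {}" and \<mu>: "\<mu> > 0"
    and r: "K-lipschitz_on E r" and H: "continuous_on E H"
    and min: "\<And>y. y \<in> Y \<Longrightarrow> \<exists>p\<in>E. \<forall>x\<in>E.
      inner y (r x) + H x \<ge> inner y (r p) + H p + \<mu> * (norm (x - p))\<^sup>2"
  obtains p y where "p \<in> E" "y \<in> Y"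
    "\<And>x. x \<in> E \<Longrightarrow> inner y (r x) + H x \<ge> inner y (r p) + H p + \<mu> * (norm (x - p))\<^sup>2"
    "\<And>y'. y' \<in> Y \<Longrightarrow> inner y' (r p) \<le> inner y (r p)"
proof -
  have K: "K \<ge> 0" using r by (rule lipschitz_on_nonneg)
  obtain P where P: "\<And>y. y \<in> Y \<Longrightarrow> P y \<in> E"
    and Pmin: "\<And>y x. y \<in> Y \<Longrightarrow> x \<in> E \<Longrightarrow>
      inner y (r x) + H x \<ge> inner y (r (P y)) + H (P y) + \<mu> * (norm (x - P y))\<^sup>2"
    using min by metis
  define c where "c = K / (2 * \<mu>)"
  have c: "c \<ge> 0" using K \<mu> by (simp add: c_def)
  have Plip: "norm (P y' - P y) \<le> c * norm (y' - y)" if y: "y \<in> Y" "y' \<in> Y" for y y'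
  proof -
    let ?\<delta> = "norm (P y' - P y)"
    have "inner (y - y') (r (P y') - r (P y)) \<ge> 2 * \<mu> * ?\<delta>\<^sup>2"
      using Pmin[OF y(1) P[OF y(2)]] Pmin[OF y(2) P[OF y(1)]]
      by (simp add: inner_diff_left inner_diff_right norm_minus_commute)
    moreover have "inner (y - y') (r (P y') - r (P y)) \<le> norm (y' - y) * (K * ?\<delta>)"
      using norm_cauchy_schwarz[of "y - y'" "r (P y') - r (P y)"]
        mult_left_mono[OF lipschitz_onD[OF r P[OF y(2)] P[OF y(1)]] norm_ge_zero[of "y - y'"]]
      by (simp add: dist_norm norm_minus_commute)
    ultimately have "?\<delta> * (2 * \<mu> * ?\<delta>) \<le> ?\<delta> * (K * norm (y' - y))"
      by (simp add: power2_eq_square mult_ac)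
    then have "2 * \<mu> * ?\<delta> \<le> K * norm (y' - y)"
      using K by (cases "?\<delta> = 0") (simp_all add: mult_le_cancel_left)
    then show ?thesis using \<mu> by (simp add: c_def field_simps)
  qed
  have "c-lipschitz_on Y P"
    by (rule lipschitz_onI) (auto simp: dist_norm Plip c)
  then have Pc: "continuous_on Y P" by (rule lipschitz_on_continuous_on)
  have "continuous_on Y (\<lambda>y. inner y (r (P y)) + H (P y))"
    using P by (intro continuous_intros continuous_on_compose2[OF H Pc]
        continuous_on_compose2[OF lipschitz_on_continuous_on[OF r] Pc]) auto
  then obtain y where y: "y \<in> Y"
    and ymax: "\<And>z. z \<in> Y \<Longrightarrow> inner z (r (P z)) + H (P z) \<le> inner y (r (P y)) + H (P y)"
    using continuous_attains_sup[OF Y(1,3)] by blast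
  have "inner y' (r (P y)) \<le> inner y (r (P y))" if y': "y' \<in> Y" for y'
  proof (rule ccontr)
    assume neg: "\<not> ?thesis"
    define v where "v = inner (y' - y) (r (P y))"
    define B where "B = K * c * (norm (y' - y))\<^sup>2"
    have v: "v > 0" using neg by (simp add: v_def inner_diff_left)
    have bound: "v \<le> t * B" if t: "0 < t" "t \<le> 1" for t
    proof -
      let ?z = "y + t *\<^sub>R (y' - y)"
      have "?z = (1 - t) *\<^sub>R y + t *\<^sub>R y'" by (simp add: algebra_simps)
      then have z: "?z \<in> Y" using Y(2) y y' t by (auto simp: convex_alt)
      have "0 \<le> \<mu> * (norm (P ?z - P y))\<^sup>2" using \<mu> by simp
      with ymax[OF z] Pmin[OF y P[OF z]] have "t * inner (y' - y) (r (P ?z)) \<le> 0"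
        by (simp add: inner_add_left)
      then have "inner (y' - y) (r (P ?z)) \<le> 0" using t by (simp add: mult_le_0_iff)
      then have "v \<le> inner (y' - y) (r (P y) - r (P ?z))"
        by (simp add: v_def inner_diff_right)
      also have "\<dots> \<le> norm (y' - y) * norm (r (P y) - r (P ?z))"
        by (rule norm_cauchy_schwarz)
      also have "\<dots> \<le> norm (y' - y) * (K * (c * (t * norm (y' - y))))"
      proof (rule mult_left_mono)
        have "norm (r (P y) - r (P ?z)) \<le> K * norm (P y - P ?z)"
          using lipschitz_onD[OF r P[OF y] P[OF z]] by (simp add: dist_norm)
        also have "\<dots> \<le> K * (c * norm (y - ?z))"
          using Plip[OF z y] K by (rule mult_left_mono)
        also have "norm (y - ?z) = t * norm (y' - y)" using t by simp
        finally show "norm (r (P y) - r (P ?z)) \<le> K * (c * (t * norm (y' - y)))" .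
      qed simp
      finally show ?thesis by (simp add: B_def power2_eq_square mult_ac)
    qed
    have B: "B > 0" using bound[of 1] v by simp
    have "v \<le> min 1 (v / (2 * B)) * B" using v B by (intro bound) auto
    also have "\<dots> \<le> v / (2 * B) * B" using B by (intro mult_right_mono) auto
    finally show False using v B by simp
  qed
  with y P[OF y] Pmin[OF y] show thesis by (intro that[of "P y" y])
qed

text \<open>
  An \<open>L\<close>-Lipschitz partial gradient makes the objective plus \<open>L * (norm (z - x))\<^sup>2\<close> strongly convex
  in \<open>z\<close>, so the minimax theorem applies. The stationarity equation holds at the minimiser for the
  saddle multiplier \<open>y\<close>, and strong convexity identifies that minimiser with \<open>p\<close>.
\<close>

lemma proximal_saddle_point:
  fixes r :: "fvec \<Rightarrow> fvec" and H :: "fvec \<Rightarrow> real"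
  assumes Y: "compact Y" "convex Y" "Y \<noteq> {}" and L: "L > 0" and x: "x \<in> euclid d"
    and r: "K-lipschitz_on (euclid d) r" and H: "continuous_on (euclid d) H"
    and g: "\<And>z y. z \<in> euclid d \<Longrightarrow> y \<in> Y \<Longrightarrow> g z y \<in> euclid d"
    and der: "\<And>z y. z \<in> euclid d \<Longrightarrow> y \<in> Y \<Longrightarrow>
      ((\<lambda>z. inner y (r z) + H z) has_derivative (\<lambda>h. inner (g z y) h)) (at z)"
    and lip: "\<And>z z' y. z \<in> euclid d \<Longrightarrow> z' \<in> euclid d \<Longrightarrow> y \<in> Y \<Longrightarrow>
      norm (g z y - g z' y) \<le> L * norm (z - z')"
  obtains p y where "p \<in> euclid d" "y \<in> Y" "g p y = (2 * L) *\<^sub>R (x - p)"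
    "\<And>z. z \<in> euclid d \<Longrightarrow> inner y (r z) + H z + L * (norm (z - x))\<^sup>2 \<ge>
        inner y (r p) + H p + L * (norm (p - x))\<^sup>2 + L / 2 * (norm (z - p))\<^sup>2"
    "\<And>y'. y' \<in> Y \<Longrightarrow> inner y' (r p) \<le> inner y (r p)"
proof -
  define H' where "H' z = H z + L * (norm (z - x))\<^sup>2" for z
  have cH': "continuous_on (euclid d) H'"
    unfolding H'_def by (intro continuous_intros H)
  have smin: "\<exists>p\<in>euclid d. g p y = (2 * L) *\<^sub>R (x - p) \<and> (\<forall>z\<in>euclid d.
      inner y (r z) + H' z \<ge> inner y (r p) + H' p + L / 2 * (norm (z - p))\<^sup>2)" if y: "y \<in> Y" for y
  proof -
    let ?G = "\<lambda>z. inner y (r z) + H' z" and ?g = "\<lambda>z. g z y + (2 * L) *\<^sub>R (z - x)"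
    have taylor: "\<bar>?G z' - ?G z - inner (?g z) (z' - z) - L * (norm (z' - z))\<^sup>2\<bar>
        \<le> L / 2 * (norm (z' - z))\<^sup>2" if z: "z \<in> euclid d" "z' \<in> euclid d" for z z'
    proof -
      have "(norm (z' - x))\<^sup>2 - (norm (z - x))\<^sup>2 = 2 * inner (z - x) (z' - z) + (norm (z' - z))\<^sup>2"
        by (simp add: power2_norm_eq_inner inner_diff_left inner_diff_right inner_commute)
      then have "L * ((norm (z' - x))\<^sup>2 - (norm (z - x))\<^sup>2)
          = L * (2 * inner (z - x) (z' - z) + (norm (z' - z))\<^sup>2)"
        by (rule arg_cong)
      then have "L * (norm (z' - x))\<^sup>2 - L * (norm (z - x))\<^sup>2
          = 2 * L * inner (z - x) (z' - z) + L * (norm (z' - z))\<^sup>2"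
        by (simp add: right_diff_distrib distrib_left)
      moreover have "\<bar>(inner y (r z') + H z') - (inner y (r z) + H z) - inner (g z y) (z' - z)\<bar>
          \<le> L / 2 * (norm (z' - z))\<^sup>2"
        by (rule lipschitz_gradient_quadratic_remainder
            [OF subspace_imp_convex[OF subspace_euclid] z der[OF _ y] lip[OF _ _ y]])
      ultimately show ?thesis
        unfolding H'_def inner_add_left inner_scaleR_left by linarith
    qed
    have cr: "continuous_on (euclid d) r" by (rule lipschitz_on_continuous_on[OF r])
    obtain p where "p \<in> euclid d" "?g p = 0"
      "\<And>z. z \<in> euclid d \<Longrightarrow> ?G z \<ge> ?G p + L / 2 * (norm (z - p))\<^sup>2"
    proof (rule strong_minimum_exists[of d ?G "L / 2" ?g "3 / 2 * L"])
      show "continuous_on (euclid d) ?G" by (intro continuous_intros cr cH')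
      show "?g z \<in> euclid d" if "z \<in> euclid d" for z
        using that x g y by (intro subspace_add subspace_scale subspace_diff subspace_euclid) auto
      show "?G z' \<ge> ?G z + inner (?g z) (z' - z) + L / 2 * (norm (z' - z))\<^sup>2"
        "?G z' \<le> ?G z + inner (?g z) (z' - z) + 3 / 2 * L * (norm (z' - z))\<^sup>2"
        if "z \<in> euclid d" "z' \<in> euclid d" for z z'
        using taylor[OF that] by (simp_all only: abs_le_iff) linarith+
    qed (use L in auto)
    moreover from \<open>?g p = 0\<close> have "g p y = (2 * L) *\<^sub>R (x - p)"
      by (simp add: scaleR_right_diff_distrib eq_neg_iff_add_eq_0 algebra_simps)
    ultimately show ?thesis by blast
  qed
  obtain p y where p: "p \<in> euclid d" and y: "y \<in> Y"
    and pmin: "\<And>z. z \<in> euclid d \<Longrightarrow>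
      inner y (r z) + H' z \<ge> inner y (r p) + H' p + L / 2 * (norm (z - p))\<^sup>2"
    and ymax: "\<And>y'. y' \<in> Y \<Longrightarrow> inner y' (r p) \<le> inner y (r p)"
  proof (rule saddle_point_exists[OF Y _ r cH', of "L / 2"])
    show "\<exists>p\<in>euclid d. \<forall>z\<in>euclid d.
        inner y (r z) + H' z \<ge> inner y (r p) + H' p + L / 2 * (norm (z - p))\<^sup>2" if "y \<in> Y" for y
      using smin[OF that] by blast
  qed (use L in auto)
  obtain p' where p': "p' \<in> euclid d" "g p' y = (2 * L) *\<^sub>R (x - p')"
    "\<And>z. z \<in> euclid d \<Longrightarrow> inner y (r z) + H' z \<ge> inner y (r p') + H' p' + L / 2 * (norm (z - p'))\<^sup>2"
    using smin[OF y] by blast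
  have "L / 2 * (norm (p' - p))\<^sup>2 + L / 2 * (norm (p - p'))\<^sup>2 \<le> 0"
    using pmin[OF p'(1)] p'(3)[OF p] by linarith
  then have "p' = p" using L by (simp add: norm_minus_commute mult_le_0_iff)
  with p y pmin ymax p'(2) show thesis
    by (intro that[of p y]) (auto simp: H'_def add.assoc)
qed

text \<open>
  A proximal point that is a strong minimiser determines the Moreau gradient. The envelope lies
  below the quadratic obtained by freezing \<open>p\<close>, and above it up to \<open>O(norm (x' - x)\<^sup>2)\<close> because
  the proximal map is Lipschitz.
\<close>

lemma moreau_gradient:
  assumes X: "setX I = euclid (dimx I)" and L: "L > 0" and x: "x \<in> setX I" and p: "p \<in> setX I"
    and min: "\<And>z. z \<in> setX I \<Longrightarrow> primal I z + L * (norm (z - x))\<^sup>2 \<ge>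
      primal I p + L * (norm (p - x))\<^sup>2 + L / 2 * (norm (z - p))\<^sup>2"
    and ex: "\<And>x'. x' \<in> setX I \<Longrightarrow> \<exists>p'\<in>setX I. \<forall>z\<in>setX I. primal I z + L * (norm (z - x'))\<^sup>2 \<ge>
      primal I p' + L * (norm (p' - x'))\<^sup>2 + L / 2 * (norm (z - p'))\<^sup>2"
  shows "prox_set I (1 / (2 * L)) x = {p}"
    and "moreau I (1 / (2 * L)) differentiable (at x within euclid (dimx I))"
    and "moreau_grad I (1 / (2 * L)) x = grad_map (1 / (2 * L)) x p"
proof -
  have pos: "L / 2 * (norm w)\<^sup>2 \<ge> 0" for w :: fvec using L by simp
  have "z = p" if z: "z \<in> setX I"
    and zmin: "primal I z + L * (norm (z - x))\<^sup>2 \<le> primal I p + L * (norm (p - x))\<^sup>2" for z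
  proof -
    have "L / 2 * (norm (z - p))\<^sup>2 \<le> 0" using min[OF z] zmin by linarith
    then show ?thesis using L by (simp add: mult_le_0_iff)
  qed
  moreover have "primal I p + L * (norm (p - x))\<^sup>2 \<le> primal I z + L * (norm (z - x))\<^sup>2"
    if "z \<in> setX I" for z using min[OF that] pos[of "z - p"] by linarith
  ultimately show "prox_set I (1 / (2 * L)) x = {p}"
    using p by (auto simp: prox_set_def is_arg_min_linorder)
  have env: "moreau I (1 / (2 * L)) x' = primal I p' + L * (norm (p' - x'))\<^sup>2"
    if p': "p' \<in> setX I" and m: "\<And>z. z \<in> setX I \<Longrightarrow> primal I z + L * (norm (z - x'))\<^sup>2 \<ge>
      primal I p' + L * (norm (p' - x'))\<^sup>2 + L / 2 * (norm (z - p'))\<^sup>2" for x' p'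
  proof -
    have "(INF z\<in>euclid (dimx I). primal_ext I z
        + ereal (1 / (2 * (1 / (2 * L))) * (norm (z - x'))\<^sup>2))
      = (INF z\<in>setX I. ereal (primal I z + L * (norm (z - x'))\<^sup>2))"
      unfolding X by (rule INF_cong) (auto simp: primal_ext_def convex_indicator_def X)
    also have "\<dots> = ereal (primal I p' + L * (norm (p' - x'))\<^sup>2)"
    proof (rule antisym)
      show "(INF z\<in>setX I. ereal (primal I z + L * (norm (z - x'))\<^sup>2))
          \<le> ereal (primal I p' + L * (norm (p' - x'))\<^sup>2)"
        by (rule INF_lower[OF p'])
      show "ereal (primal I p' + L * (norm (p' - x'))\<^sup>2)
          \<le> (INF z\<in>setX I. ereal (primal I z + L * (norm (z - x'))\<^sup>2))"
        using m pos by (intro INF_greatest) (smt (verit) ereal_less_eq(3))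
    qed
    finally show ?thesis by (simp add: moreau_def)
  qed
  define g where "g = (2 * L) *\<^sub>R (x - p)"
  have "\<bar>moreau I (1 / (2 * L)) x' - moreau I (1 / (2 * L)) x - inner g (x' - x)\<bar>
      \<le> 7 * L * (norm (x' - x))\<^sup>2" if x': "x' \<in> euclid (dimx I)" for x'
  proof -
    define \<delta> where "\<delta> = x' - x"
    obtain p' where p': "p' \<in> setX I"
      and min': "\<And>z. z \<in> setX I \<Longrightarrow> primal I z + L * (norm (z - x'))\<^sup>2 \<ge>
        primal I p' + L * (norm (p' - x'))\<^sup>2 + L / 2 * (norm (z - p'))\<^sup>2"
      using ex[of x'] x' X by blast
    have shift: "(norm (q - x'))\<^sup>2 = (norm (q - x))\<^sup>2 + 2 * inner (x - q) \<delta> + (norm \<delta>)\<^sup>2" for q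
      by (simp add: \<delta>_def power2_norm_eq_inner inner_diff_left inner_diff_right inner_commute)
    have shiftL: "L * (norm (q - x'))\<^sup>2
        = L * (norm (q - x))\<^sup>2 + 2 * L * inner (x - q) \<delta> + L * (norm \<delta>)\<^sup>2" for q
      unfolding shift by (simp add: algebra_simps)
    define e where "e = norm (p' - p)"
    have e: "e \<ge> 0" by (simp add: e_def)
    have cs: "inner (p' - p) \<delta> \<le> e * norm \<delta>"
      unfolding e_def by (rule norm_cauchy_schwarz)
    have "L * e\<^sup>2 \<le> 2 * L * inner (p' - p) \<delta>"
      using min[OF p'] min'[OF p] shiftL[of p] shiftL[of p']
      by (simp add: e_def norm_minus_commute inner_diff_left algebra_simps)
    also have "\<dots> \<le> 2 * L * (e * norm \<delta>)" using cs L by simp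
    finally have "e * e \<le> e * (2 * norm \<delta>)" using L by (simp add: power2_eq_square)
    then have e2: "e \<le> 2 * norm \<delta>" using e by (cases "e = 0") (simp_all add: mult_le_cancel_left)
    have "inner (p' - p) \<delta> \<le> 2 * (norm \<delta>)\<^sup>2"
      using cs mult_right_mono[OF e2 norm_ge_zero[of \<delta>]] by (simp add: power2_eq_square mult.assoc)
    then have "2 * L * inner (p' - p) \<delta> \<le> 2 * L * (2 * (norm \<delta>)\<^sup>2)"
      using L by (intro mult_left_mono) auto
    moreover have "0 \<le> L * (norm \<delta>)\<^sup>2" using L by simp
    moreover note min[OF p'] min'[OF p] shiftL[of p] shiftL[of p'] pos[of "p' - p"] pos[of "p - p'"]
    moreover have "moreau I (1 / (2 * L)) x = primal I p + L * (norm (p - x))\<^sup>2"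
      by (rule env[OF p]) (rule min)
    moreover have "moreau I (1 / (2 * L)) x' = primal I p' + L * (norm (p' - x'))\<^sup>2"
      by (rule env[OF p']) (rule min')
    ultimately show ?thesis
      unfolding g_def \<delta>_def[symmetric] inner_scaleR_left inner_diff_left right_diff_distrib abs_le_iff
      by linarith
  qed
  then have der: "(moreau I (1 / (2 * L)) has_derivative (\<lambda>h. inner g h))
      (at x within euclid (dimx I))"
    by (intro has_derivative_quadratic_remainder[where K = "7 * L"] bounded_linear_inner_right)
  then show "moreau I (1 / (2 * L)) differentiable (at x within euclid (dimx I))"
    by (auto simp: differentiable_def)
  have "g \<in> euclid (dimx I)"
    using x p X by (auto simp: g_def intro!: subspace_scale subspace_diff subspace_euclid)
  with der have g: "is_gradient_on (euclid (dimx I)) (moreau I (1 / (2 * L))) x g"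
    by (simp add: is_gradient_on_def)
  have "x \<in> euclid (dimx I)" using x X by simp
  then have "moreau_grad I (1 / (2 * L)) x = g"
    unfolding moreau_grad_def gradient_on_def
    using g is_gradient_on_unique[OF subspace_euclid] by (intro the_equality) blast+
  then show "moreau_grad I (1 / (2 * L)) x = grad_map (1 / (2 * L)) x p"
    by (simp add: g_def grad_map_def)
qed

section \<open>One-dimensional profiles\<close>

text \<open>
  The switch and the potential are built from shifted copies of \<open>half_square\<close>, a primitive of the
  positive part. This makes \<open>switch\<close> and \<open>slide\<close> continuously differentiable with the piecewise linear
  derivatives \<open>bump\<close> (a hat over \<open>[1, 3]\<close>) and \<open>plateau\<close> (a trapezoid over \<open>[0, 4]\<close> which equals
  \<open>1\<close> on \<open>[1, 3]\<close>). Both derivatives vanish for nonpositive arguments, so a zero coordinate reveals nothing.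
\<close>

definition half_square :: "real \<Rightarrow> real" where
  "half_square u = (max 0 u)\<^sup>2 / 2"

definition bump :: "real \<Rightarrow> real" where
  "bump u = max 0 (u - 1) - 2 * max 0 (u - 2) + max 0 (u - 3)"

definition switch :: "real \<Rightarrow> real" where
  "switch u = half_square (u - 1) - 2 * half_square (u - 2) + half_square (u - 3)"

definition plateau :: "real \<Rightarrow> real" where
  "plateau u = max 0 u - max 0 (u - 1) - max 0 (u - 3) + max 0 (u - 4)"

definition slide :: "real \<Rightarrow> real" where
  "slide u = half_square u - half_square (u - 1) - half_square (u - 3) + half_square (u - 4)"

lemma half_square_deriv: "(half_square has_real_derivative max 0 u) (at u)"
proof -
  have "\<bar>half_square v - half_square u - max 0 u * (v - u)\<bar> \<le> 1 * (norm (v - u))\<^sup>2" for v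
  proof -
    have eq: "half_square v - half_square u - max 0 u * (v - u)
        = (max 0 v - max 0 u)\<^sup>2 / 2 + max 0 u * (max 0 v - v)"
      by (cases "u \<ge> 0") (simp_all add: half_square_def field_simps power2_eq_square)
    have 1: "(max 0 v - max 0 u)\<^sup>2 \<le> (v - u)\<^sup>2"
      by (rule abs_le_square_iff[THEN iffD1]) auto
    have 2: "2 * (max 0 u * (max 0 v - v)) \<le> (v - u)\<^sup>2"
    proof (cases "u \<ge> 0 \<and> v \<le> 0")
      case True
      then have "max 0 u = u" "max 0 v = 0" by auto
      moreover have "(v - u)\<^sup>2 = v\<^sup>2 + u\<^sup>2 - 2 * (u * v)" by (simp add: power2_diff)
      ultimately show ?thesis using zero_le_power2[of u] zero_le_power2[of v] by simp
    next
      case False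
      then have "max 0 u * (max 0 v - v) = 0" by auto
      then show ?thesis by (metis mult_zero_right zero_le_power2)
    qed
    have 3: "0 \<le> max 0 u * (max 0 v - v)" by simp
    show ?thesis unfolding eq real_norm_def power2_abs using 1 2 3 by (simp add: abs_le_iff)
  qed
  then show ?thesis
    unfolding has_field_derivative_def
    by (intro has_derivative_quadratic_remainder[where K = 1] bounded_linear_mult_right) auto
qed

lemma half_square_shift_deriv:
  "((\<lambda>u. half_square (u - c)) has_real_derivative max 0 (u - c)) (at u)"
proof -
  have "((\<lambda>u. u - c) has_real_derivative 1) (at u)" by (auto intro!: derivative_eq_intros)
  from DERIV_chain2[OF half_square_deriv this] show ?thesis by simp
qed

lemma switch_deriv: "(switch has_real_derivative bump u) (at u)"
  using DERIV_add[OF DERIV_diff[OF half_square_shift_deriv[of 1]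
        DERIV_cmult[OF half_square_shift_deriv[of 2], of 2]] half_square_shift_deriv[of 3], of u]
  unfolding switch_def[abs_def] bump_def .

lemma slide_deriv: "(slide has_real_derivative plateau u) (at u)"
  using DERIV_add[OF DERIV_diff[OF DERIV_diff[OF half_square_deriv
        half_square_shift_deriv[of 1]] half_square_shift_deriv[of 3]] half_square_shift_deriv[of 4]]
  unfolding slide_def[abs_def] plateau_def .

lemma bump_eq: "bump u = max 0 (min (u - 1) (3 - u))"
  by (cases "u \<le> 1"; cases "u \<le> 2"; cases "u \<le> 3") (simp_all add: bump_def)

lemma plateau_eq: "plateau u = max 0 (min 1 (min u (4 - u)))"
  by (cases "u \<le> 0"; cases "u \<le> 1"; cases "u \<le> 3"; cases "u \<le> 4") (simp_all add: plateau_def)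

lemma bump_nonneg: "0 \<le> bump u"
  by (simp add: bump_eq)

lemma bump_le_plateau: "bump u \<le> plateau u"
  by (simp add: bump_eq plateau_eq max_def min_def)

lemma plateau_le_1: "plateau u \<le> 1"
  by (simp add: plateau_eq)

lemma plateau_eq_1: "1 \<le> u \<Longrightarrow> u \<le> 3 \<Longrightarrow> plateau u = 1"
  by (simp add: plateau_eq)

lemma bump_lipschitz: "\<bar>bump u - bump v\<bar> \<le> \<bar>u - v\<bar>"
proof -
  have "\<bar>bump u - bump v\<bar> \<le> \<bar>min (u - 1) (3 - u) - min (v - 1) (3 - v)\<bar>"
    unfolding bump_eq by linarith
  also have "\<dots> \<le> \<bar>u - v\<bar>" by linarith
  finally show ?thesis .
qed

lemma plateau_lipschitz: "\<bar>plateau u - plateau v\<bar> \<le> \<bar>u - v\<bar>"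
proof -
  have "\<bar>plateau u - plateau v\<bar> \<le> \<bar>min 1 (min u (4 - u)) - min 1 (min v (4 - v))\<bar>"
    unfolding plateau_eq by linarith
  also have "\<dots> \<le> \<bar>min u (4 - u) - min v (4 - v)\<bar>" by linarith
  also have "\<dots> \<le> \<bar>u - v\<bar>" by linarith
  finally show ?thesis .
qed

lemma switch_lipschitz: "\<bar>switch u - switch v\<bar> \<le> \<bar>u - v\<bar>"
proof -
  have "0 \<le> switch v - switch u \<and> switch v - switch u \<le> v - u" if "u \<le> v" for u v
  proof
    have "switch u \<le> switch v"
      using switch_deriv bump_nonneg by (intro DERIV_nonneg_imp_nondecreasing[OF that]) blast
    then show "0 \<le> switch v - switch u" by simp
    have "u - switch u \<le> v - switch v"
    proof (rule DERIV_nonneg_imp_nondecreasing[OF that])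
      fix x
      have "((\<lambda>x. x - switch x) has_real_derivative 1 - bump x) (at x)"
        by (auto intro!: derivative_eq_intros switch_deriv)
      moreover have "1 - bump x \<ge> 0" using bump_le_plateau[of x] plateau_le_1[of x] by linarith
      ultimately show "\<exists>y. ((\<lambda>x. x - switch x) has_real_derivative y) (at x) \<and> y \<ge> 0" by blast
    qed
    then show "switch v - switch u \<le> v - u" by simp
  qed
  from this[of u v] this[of v u] show ?thesis by linarith
qed

lemma switch_eq_0: "u \<le> 1 \<Longrightarrow> switch u = 0"
  by (simp add: switch_def half_square_def)

lemma switch_eq_1: "u \<ge> 3 \<Longrightarrow> switch u = 1"
  by (simp add: switch_def half_square_def power2_eq_square field_simps)

lemma slide_le_3: "slide u \<le> 3"
proof -
  have "slide u \<le> slide (max u 4)"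
  proof (rule DERIV_nonneg_imp_nondecreasing[of u "max u 4" slide])
    fix x :: real
    have "0 \<le> plateau x" by (rule order.trans[OF bump_nonneg bump_le_plateau])
    then show "\<exists>y. DERIV slide x :> y \<and> 0 \<le> y" using slide_deriv by blast
  qed simp
  also have "slide (max u 4) = 3"
    by (simp add: slide_def half_square_def power2_eq_square field_simps)
  finally show ?thesis .
qed

lemma slide_0: "slide 0 = 0"
  by (simp add: slide_def half_square_def)

section \<open>Norm bounds from coordinates\<close>

lemma norm_le_coordwise:
  assumes "v \<in> euclid d" "w \<in> euclid d" "\<And>i. i < d \<Longrightarrow> \<bar>coord v i\<bar> \<le> \<bar>coord w i\<bar>"
  shows "norm v \<le> norm w"
proof -
  have "(norm v)\<^sup>2 \<le> (norm w)\<^sup>2"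
    unfolding norm_euclid[OF assms(1)] norm_euclid[OF assms(2)]
    using assms(3) by (intro sum_mono) (auto simp: abs_le_square_iff)
  then show ?thesis by (rule power2_le_imp_le) simp
qed

lemma norm_mk_vec_le:
  assumes "x \<in> euclid e" "d \<le> e" "\<And>i. i < d \<Longrightarrow> \<bar>f i\<bar> \<le> c * \<bar>coord x i\<bar>" "c \<ge> 0"
  shows "norm (mk_vec d f) \<le> c * norm x"
proof -
  have "norm (mk_vec d f) \<le> norm (c *\<^sub>R x)"
    using assms by (intro norm_le_coordwise[of _ e] subspace_scale subspace_euclid)
      (auto simp: mem_euclid abs_mult)
  then show ?thesis using assms(4) by simp
qed

text \<open>
  The Cauchy-Schwarz inequality with weights \<open>sqrt (V i j)\<close>; row and column sums bound the operator
  norm of a nonnegative matrix.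
\<close>

lemma Schur_test:
  fixes V :: "nat \<Rightarrow> nat \<Rightarrow> real"
  assumes V: "\<And>i j. V i j \<ge> 0" and row: "\<And>i. i < d \<Longrightarrow> (\<Sum>j<d. V i j) \<le> R"
    and col: "\<And>j. j < d \<Longrightarrow> (\<Sum>i<d. V i j) \<le> S" and R: "R \<ge> 0"
  shows "(norm (mk_vec d (\<lambda>i. \<Sum>j<d. V i j * \<bar>coord x j\<bar>)))\<^sup>2 \<le> R * S * (norm (mk_vec d (coord x)))\<^sup>2"
proof -
  have "(\<Sum>j<d. V i j * \<bar>coord x j\<bar>)\<^sup>2 \<le> R * (\<Sum>j<d. V i j * (coord x j)\<^sup>2)" if i: "i < d" for i
  proof -
    have "(\<Sum>j<d. V i j * \<bar>coord x j\<bar>)\<^sup>2 = (\<Sum>j<d. sqrt (V i j) * (sqrt (V i j) * \<bar>coord x j\<bar>))\<^sup>2"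
      using V by (simp flip: mult.assoc)
    also have "\<dots> \<le> (\<Sum>j<d. (sqrt (V i j))\<^sup>2) * (\<Sum>j<d. (sqrt (V i j) * \<bar>coord x j\<bar>)\<^sup>2)"
      by (rule Cauchy_Schwarz_ineq_sum)
    also have "\<dots> = (\<Sum>j<d. V i j) * (\<Sum>j<d. V i j * (coord x j)\<^sup>2)"
      using V by (simp add: power_mult_distrib)
    also have "\<dots> \<le> R * (\<Sum>j<d. V i j * (coord x j)\<^sup>2)"
      using row[OF i] V by (intro mult_right_mono sum_nonneg) auto
    finally show ?thesis .
  qed
  then have "(\<Sum>i<d. (\<Sum>j<d. V i j * \<bar>coord x j\<bar>)\<^sup>2)
      \<le> (\<Sum>i<d. R * (\<Sum>j<d. V i j * (coord x j)\<^sup>2))"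
    by (intro sum_mono) auto
  also have "\<dots> = R * (\<Sum>j<d. (\<Sum>i<d. V i j) * (coord x j)\<^sup>2)"
    unfolding sum_distrib_left[symmetric] sum_distrib_right by (subst sum.swap) simp
  also have "\<dots> \<le> R * (\<Sum>j<d. S * (coord x j)\<^sup>2)"
    using col R by (intro mult_left_mono sum_mono mult_right_mono) auto
  finally show ?thesis by (simp add: norm_euclid[of _ d] sum_distrib_left mult.assoc)
qed

section \<open>The chain instance\<close>

text \<open>
  \<open>M\<close> is the number of blocks. The last assumption keeps the dual vector of a near-stationary point
  inside the ball of radius \<open>D / 2\<close>.
\<close>

locale chain_instance =
  fixes L D \<epsilon> :: real and n M :: nat
  assumes L_pos: "L > 0" and eps_pos: "\<epsilon> > 0" and n_pos: "n > 0" and M_pos: "M > 0"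
    and n_le: "96 * \<epsilon> * real n \<le> L * D"
begin

text \<open>
  The scales are tied together as follows. The slope \<open>b\<close> makes the gradient of \<open>n\<close> equally sloped
  coordinates have norm \<open>\<epsilon>\<close>. The step \<open>a\<close> is the distance over which a slope of order \<open>b\<close> may change
  when the smoothness constant is \<open>L\<close>. The bound \<open>cap\<close> on a dual coordinate corresponds to a force
  \<open>\<kappa> * cap = 2 * n * b\<close>: it exceeds what the Hardy inequality permits, and spread over \<open>n\<close> sensors it
  exerts the slope \<open>2 * b\<close>, less than the slope \<open>3 * b\<close> of the potential.
\<close>

definition T :: nat where "T = 2 * n * M"
definition \<kappa> :: real where "\<kappa> = L / 12"
definition b :: real where "b = \<epsilon> / sqrt (real n)"
definition a :: real where "a = 12 * b / L"
definition cap :: real where "cap = 2 * real n * b / \<kappa>"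

text \<open>
  \<open>pass j l\<close> and \<open>sense j l\<close> are the weights with which coordinate \<open>l\<close> enters the drive of coordinate
  \<open>j\<close>: the former inside a block, the latter across a block boundary.
\<close>

definition pass :: "nat \<Rightarrow> nat \<Rightarrow> real" where
  "pass j l = (if Suc l = j \<and> j mod (2 * n) \<noteq> 0 then 1 else 0)"

definition sense :: "nat \<Rightarrow> nat \<Rightarrow> real" where
  "sense j l = (if j mod (2 * n) = 0 \<and> l < j \<and> j \<le> l + n then 1 / real n else 0)"

definition drive :: "fvec \<Rightarrow> nat \<Rightarrow> real" where
  "drive x j = (if j = 0 then a else 0)
     + (\<Sum>l<T. pass j l * coord x l + sense j l * (a * switch (coord x l / a)))"

definition res :: "fvec \<Rightarrow> fvec" where
  "res x = mk_vec T (\<lambda>j. \<kappa> * (drive x j - coord x j))"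

definition pot :: "fvec \<Rightarrow> real" where
  "pot x = - (\<Sum>l<T. 3 * b * (a * slide (coord x l / a)))"

text \<open>The partial gradient of the objective in \<open>x\<close>; the one in \<open>y\<close> is \<open>res x\<close>.\<close>

definition gx :: "fvec \<Rightarrow> fvec \<Rightarrow> fvec" where
  "gx x y = mk_vec T (\<lambda>l.
     \<kappa> * ((\<Sum>j<T. coord y j * (pass j l + sense j l * bump (coord x l / a))) - coord y l)
     - 3 * b * plateau (coord x l / a))"

text \<open>
  The extra coordinate \<open>T\<close> may take both signs; it contributes two antipodal points of the ball, so
  that the diameter is exactly \<open>D\<close>.
\<close>

definition Y :: "fvec set" where
  "Y = {y \<in> euclid (Suc T). (\<forall>j<T. 0 \<le> coord y j \<and> coord y j \<le> cap) \<and> norm y \<le> D / 2}"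

definition I :: inst where
  "I = \<lparr>dimx = T, dimy = Suc T, setX = euclid T, setY = Y,
        objective = (\<lambda>(x, y). inner y (res x) + pot x)\<rparr>"

lemma I_simps [simp]:
  "dimx I = T" "dimy I = Suc T" "setX I = euclid T" "setY I = Y"
  "objective I (x, y) = inner y (res x) + pot x"
  by (simp_all add: I_def)

lemma kappa_pos: "\<kappa> > 0" using L_pos by (simp add: \<kappa>_def)
lemma b_pos: "b > 0" using eps_pos n_pos by (simp add: b_def)
lemma a_pos: "a > 0" using b_pos L_pos by (simp add: a_def)
lemma cap_pos: "cap > 0" using b_pos kappa_pos n_pos by (simp add: cap_def)
lemma D_pos: "D > 0"
proof -
  have "0 < 96 * \<epsilon> * real n" using eps_pos n_pos by simp
  with n_le have "0 < L * D" by linarith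
  then show ?thesis using L_pos by (simp add: zero_less_mult_iff)
qed

lemma n_b_squared: "real n * b\<^sup>2 = \<epsilon>\<^sup>2"
  using n_pos by (simp add: b_def power_divide)

lemma kappa_cap: "\<kappa> * cap = 2 * real n * b"
  using kappa_pos by (simp add: cap_def)

lemma pass_nonneg: "pass j l \<ge> 0" and sense_nonneg: "sense j l \<ge> 0"
  by (auto simp: pass_def sense_def)

lemma row_sum: "(\<Sum>l<T. pass j l + sense j l) \<le> 1"
proof (cases "j mod (2 * n) = 0")
  case True
  have "(\<Sum>l<T. pass j l + sense j l) = (\<Sum>l\<in>{l. l < T \<and> l < j \<and> j \<le> l + n}. 1 / real n)"
    using True by (intro sum.mono_neutral_cong_right) (auto simp: pass_def sense_def)
  also have "\<dots> = card {l. l < T \<and> l < j \<and> j \<le> l + n} / real n" by simp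
  also have "\<dots> \<le> card {j - n..<j} / real n"
    using n_pos by (intro divide_right_mono of_nat_mono card_mono) auto
  also have "\<dots> \<le> 1" using n_pos by (simp add: divide_le_eq)
  finally show ?thesis .
next
  case False
  have "(\<Sum>l<T. pass j l + sense j l) \<le> (\<Sum>l<T. if l = j - 1 then 1 else 0)"
    using False by (intro sum_mono) (auto simp: pass_def sense_def)
  also have "\<dots> \<le> 1" by simp
  finally show ?thesis .
qed

text \<open>
  Block starts are \<open>2 * n\<close> apart, hence each coordinate is a sensor for at most one of them. The
  factor \<open>1 / n\<close> gained here keeps the curvature of the switches of order \<open>L\<close>, although each switch
  acts on the short scale \<open>a\<close>.
\<close>

lemma sense_col_sum: "(\<Sum>j<T. sense j l) \<le> 1 / real n"
proof -
  let ?S = "{j. j < T \<and> j mod (2 * n) = 0 \<and> l < j \<and> j \<le> l + n}"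
  have "i = j" if "i \<in> ?S" "j \<in> ?S" for i j
  proof -
    have "2 * n dvd i" "2 * n dvd j" using that by (simp_all add: mod_eq_0_iff_dvd)
    then obtain p q where pq: "i = 2 * n * p" "j = 2 * n * q" by (auto elim!: dvdE)
    moreover have "i < j + n" "j < i + n" using that by auto
    ultimately have "2 * n * p < 2 * n * (q + 1)" "2 * n * q < 2 * n * (p + 1)"
      by (simp_all add: algebra_simps)
    then have "p < q + 1" "q < p + 1" unfolding mult_less_cancel1 by blast+
    then show ?thesis using pq by simp
  qed
  then have card: "card ?S \<le> 1"
    unfolding One_nat_def using card_le_Suc0_iff_eq[of ?S] by fastforce
  have "(\<Sum>j<T. sense j l) = (\<Sum>j\<in>?S. 1 / real n)"
    by (intro sum.mono_neutral_cong_right) (auto simp: sense_def)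
  also have "\<dots> = real (card ?S) * (1 / real n)" by simp
  also have "\<dots> \<le> 1 * (1 / real n)" using card by (intro mult_right_mono) auto
  finally show ?thesis by simp
qed

lemma col_sum: "(\<Sum>j<T. pass j l + sense j l) \<le> 2"
proof -
  have "(\<Sum>j<T. pass j l) \<le> (\<Sum>j<T. if j = Suc l then 1 else 0)"
    by (intro sum_mono) (auto simp: pass_def)
  also have "\<dots> \<le> 1" by simp
  finally have "(\<Sum>j<T. pass j l) \<le> 1" .
  moreover have "1 / real n \<le> 1" using n_pos by simp
  ultimately show ?thesis using sense_col_sum[of l] by (simp add: sum.distrib)
qed

lemma coupling_norm:
  assumes "x \<in> euclid e" "T \<le> e"
  shows "norm (mk_vec T (\<lambda>j. \<Sum>l<T. (pass j l + sense j l) * \<bar>coord x l\<bar>)) \<le> 2 * norm x"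
    and "norm (mk_vec T (\<lambda>l. \<Sum>j<T. (pass j l + sense j l) * \<bar>coord x j\<bar>)) \<le> 2 * norm x"
proof -
  have "norm (mk_vec T (coord x)) \<le> 1 * norm x" by (rule norm_mk_vec_le[OF assms]) auto
  then have "(norm (mk_vec T (coord x)))\<^sup>2 \<le> (norm x)\<^sup>2" by (intro power_mono) auto
  then have 2: "2 * (norm (mk_vec T (coord x)))\<^sup>2 \<le> (2 * norm x)\<^sup>2"
  proof -
    have "(2 * norm x)\<^sup>2 = 4 * (norm x)\<^sup>2" by (simp add: power_mult_distrib)
    with \<open>(norm (mk_vec T (coord x)))\<^sup>2 \<le> (norm x)\<^sup>2\<close> show ?thesis
      using zero_le_power2[of "norm x"] by linarith
  qed
  have V: "0 \<le> pass i j + sense i j" for i j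
    using pass_nonneg sense_nonneg by (rule add_nonneg_nonneg)
  show "norm (mk_vec T (\<lambda>j. \<Sum>l<T. (pass j l + sense j l) * \<bar>coord x l\<bar>)) \<le> 2 * norm x"
  proof (rule power2_le_imp_le)
    have "(norm (mk_vec T (\<lambda>j. \<Sum>l<T. (pass j l + sense j l) * \<bar>coord x l\<bar>)))\<^sup>2
        \<le> 1 * 2 * (norm (mk_vec T (coord x)))\<^sup>2"
      by (rule Schur_test[where V = "\<lambda>j l. pass j l + sense j l", OF V row_sum col_sum zero_le_one])
    also have "\<dots> \<le> (2 * norm x)\<^sup>2" using 2 by simp
    finally show "(norm (mk_vec T (\<lambda>j. \<Sum>l<T. (pass j l + sense j l) * \<bar>coord x l\<bar>)))\<^sup>2
        \<le> (2 * norm x)\<^sup>2" .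
  qed simp
  show "norm (mk_vec T (\<lambda>l. \<Sum>j<T. (pass j l + sense j l) * \<bar>coord x j\<bar>)) \<le> 2 * norm x"
  proof (rule power2_le_imp_le)
    have "(norm (mk_vec T (\<lambda>l. \<Sum>j<T. (pass j l + sense j l) * \<bar>coord x j\<bar>)))\<^sup>2
        \<le> 2 * 1 * (norm (mk_vec T (coord x)))\<^sup>2"
      by (rule Schur_test[where V = "\<lambda>l j. pass j l + sense j l", OF V col_sum row_sum zero_le_numeral])
    also have "\<dots> \<le> (2 * norm x)\<^sup>2" using 2 by simp
    finally show "(norm (mk_vec T (\<lambda>l. \<Sum>j<T. (pass j l + sense j l) * \<bar>coord x j\<bar>)))\<^sup>2
        \<le> (2 * norm x)\<^sup>2" .
  qed simp
qed

lemma drive_lipschitz: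
  "\<bar>drive x j - drive x' j\<bar> \<le> (\<Sum>l<T. (pass j l + sense j l) * \<bar>coord (x - x') l\<bar>)"
proof -
  have "\<bar>drive x j - drive x' j\<bar> = \<bar>\<Sum>l<T. pass j l * coord (x - x') l
      + sense j l * (a * switch (coord x l / a) - a * switch (coord x' l / a))\<bar>"
    unfolding drive_def add_diff_add diff_self add_0 sum_subtractf[symmetric]
    by (intro arg_cong[of _ _ abs] sum.cong) (simp_all add: algebra_simps)
  also have "\<dots> \<le> (\<Sum>l<T. \<bar>pass j l * coord (x - x') l
      + sense j l * (a * switch (coord x l / a) - a * switch (coord x' l / a))\<bar>)"
    by (rule sum_abs)
  also have "\<dots> \<le> (\<Sum>l<T. (pass j l + sense j l) * \<bar>coord (x - x') l\<bar>)"
  proof (rule sum_mono)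
    fix l
    let ?u = "coord x l / a" and ?v = "coord x' l / a"
    have "\<bar>a * switch ?u - a * switch ?v\<bar> = a * \<bar>switch ?u - switch ?v\<bar>"
      using a_pos by (simp add: abs_mult flip: right_diff_distrib)
    also have "\<dots> \<le> a * \<bar>?u - ?v\<bar>"
      using switch_lipschitz a_pos by (intro mult_left_mono) auto
    also have "\<dots> = \<bar>a * (?u - ?v)\<bar>" using a_pos by (simp add: abs_mult)
    also have "\<dots> = \<bar>coord (x - x') l\<bar>" using a_pos by (simp add: right_diff_distrib)
    finally have s: "\<bar>a * switch ?u - a * switch ?v\<bar> \<le> \<bar>coord (x - x') l\<bar>" .
    have "\<bar>pass j l * coord (x - x') l + sense j l * (a * switch ?u - a * switch ?v)\<bar>
        \<le> pass j l * \<bar>coord (x - x') l\<bar> + sense j l * \<bar>a * switch ?u - a * switch ?v\<bar>"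
      using pass_nonneg[of j l] sense_nonneg[of j l]
      by (intro order.trans[OF abs_triangle_ineq]) (simp add: abs_mult)
    also have "\<dots> \<le> pass j l * \<bar>coord (x - x') l\<bar> + sense j l * \<bar>coord (x - x') l\<bar>"
      using s sense_nonneg[of j l] by (intro add_left_mono mult_left_mono) auto
    finally show "\<bar>pass j l * coord (x - x') l + sense j l * (a * switch ?u - a * switch ?v)\<bar>
        \<le> (pass j l + sense j l) * \<bar>coord (x - x') l\<bar>" by (simp add: distrib_right)
  qed
  finally show ?thesis .
qed

lemma res_lipschitz:
  assumes "x \<in> euclid T" "x' \<in> euclid T"
  shows "norm (res x - res x') \<le> L / 4 * norm (x - x')"
proof -
  let ?\<delta> = "x - x'"
  let ?V = "mk_vec T (\<lambda>j. \<Sum>l<T. (pass j l + sense j l) * \<bar>coord ?\<delta> l\<bar>)"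
  have \<delta>: "?\<delta> \<in> euclid T" using assms by (intro subspace_diff subspace_euclid)
  have "res x - res x' = \<kappa> *\<^sub>R mk_vec T (\<lambda>j. drive x j - drive x' j) - \<kappa> *\<^sub>R ?\<delta>"
    using \<delta> by (intro fvec_eqI) (auto simp: res_def mem_euclid algebra_simps)
  also have "norm \<dots> \<le> \<kappa> * norm (mk_vec T (\<lambda>j. drive x j - drive x' j)) + \<kappa> * norm ?\<delta>"
    using norm_triangle_ineq4[of "\<kappa> *\<^sub>R mk_vec T (\<lambda>j. drive x j - drive x' j)" "\<kappa> *\<^sub>R ?\<delta>"] kappa_pos
    by simp
  also have "norm (mk_vec T (\<lambda>j. drive x j - drive x' j)) \<le> norm ?V"
  proof (rule norm_le_coordwise[of _ T])
    fix j assume "j < T"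
    then show "\<bar>coord (mk_vec T (\<lambda>j. drive x j - drive x' j)) j\<bar> \<le> \<bar>coord ?V j\<bar>"
      using drive_lipschitz[of x j x'] by (simp del: coord_simps)
  qed simp_all
  also have "norm ?V \<le> 2 * norm ?\<delta>" by (rule coupling_norm[OF \<delta> order.refl])
  finally show ?thesis using kappa_pos by (simp add: \<kappa>_def)
qed

text \<open>
  The difference splits into a change of the multipliers (\<open>A\<close> and the diagonal), a change of the
  switch slopes (\<open>B\<close>) and a change of the potential slopes (\<open>P\<close>).
\<close>

lemma gx_lipschitz:
  assumes x: "x \<in> euclid T" "x' \<in> euclid T" and y: "y \<in> Y" "y' \<in> Y"
  shows "norm (gx x y - gx x' y') \<le> L / 4 * norm (y - y') + 5 / 12 * L * norm (x - x')"
proof -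
  let ?\<delta> = "x - x'" and ?\<eta> = "y - y'"
  let ?u = "\<lambda>l. coord x l / a" and ?v = "\<lambda>l. coord x' l / a"
  define A where "A = mk_vec T (\<lambda>l. \<Sum>j<T. coord ?\<eta> j * (pass j l + sense j l * bump (?u l)))"
  define B where "B = mk_vec T (\<lambda>l. \<kappa> * (\<Sum>j<T. coord y' j * (sense j l * (bump (?u l) - bump (?v l)))))"
  define P where "P = mk_vec T (\<lambda>l. 3 * b * (plateau (?u l) - plateau (?v l)))"
  let ?V = "mk_vec T (\<lambda>l. \<Sum>j<T. (pass j l + sense j l) * \<bar>coord ?\<eta> j\<bar>)"
  have \<delta>: "?\<delta> \<in> euclid T" using x by (intro subspace_diff subspace_euclid)
  have \<eta>: "?\<eta> \<in> euclid (Suc T)" using y by (intro subspace_diff subspace_euclid) (auto simp: Y_def)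
  have uv: "\<bar>?u l - ?v l\<bar> = \<bar>coord ?\<delta> l\<bar> / a" for l
    using a_pos by (simp flip: diff_divide_distrib)
  have "gx x y - gx x' y' = \<kappa> *\<^sub>R A + B - \<kappa> *\<^sub>R mk_vec T (coord ?\<eta>) - P"
  proof (rule fvec_eqI)
    fix l
    define s where "s = (\<Sum>j<T. coord y j * (pass j l + sense j l * bump (?u l)))"
    define s' where "s' = (\<Sum>j<T. coord y' j * (pass j l + sense j l * bump (?v l)))"
    define t where "t = (\<Sum>j<T. coord ?\<eta> j * (pass j l + sense j l * bump (?u l)))"
    define t' where "t' = (\<Sum>j<T. coord y' j * (sense j l * (bump (?u l) - bump (?v l))))"
    have st: "s = s' + t + t'"
      unfolding s_def s'_def t_def t'_def sum.distrib[symmetric]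
      by (rule sum.cong) (simp_all add: algebra_simps)
    show "coord (gx x y - gx x' y') l = coord (\<kappa> *\<^sub>R A + B - \<kappa> *\<^sub>R mk_vec T (coord ?\<eta>) - P) l"
      unfolding gx_def A_def B_def P_def coord_simps coord_mk_vec
        s_def[symmetric] s'_def[symmetric] t_def[symmetric, unfolded coord_simps]
        t'_def[symmetric] st
      by (simp add: algebra_simps)
  qed
  also have "norm \<dots> \<le> \<kappa> * norm A + norm B + \<kappa> * norm (mk_vec T (coord ?\<eta>)) + norm P"
    using norm_triangle_ineq4[of "\<kappa> *\<^sub>R A + B - \<kappa> *\<^sub>R mk_vec T (coord ?\<eta>)" P]
      norm_triangle_ineq4[of "\<kappa> *\<^sub>R A + B" "\<kappa> *\<^sub>R mk_vec T (coord ?\<eta>)"]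
      norm_triangle_ineq[of "\<kappa> *\<^sub>R A" B] kappa_pos by simp
  also have "\<dots> \<le> \<kappa> * (2 * norm ?\<eta>) + L / 6 * norm ?\<delta> + \<kappa> * (1 * norm ?\<eta>) + L / 4 * norm ?\<delta>"
  proof (intro add_mono mult_left_mono)
    have "norm A \<le> norm ?V"
    proof (rule norm_le_coordwise[of _ T])
      fix l assume l: "l < T"
      have "\<bar>coord A l\<bar> \<le> (\<Sum>j<T. \<bar>coord ?\<eta> j * (pass j l + sense j l * bump (?u l))\<bar>)"
        using l by (simp add: A_def sum_abs)
      also have "\<dots> \<le> (\<Sum>j<T. (pass j l + sense j l) * \<bar>coord ?\<eta> j\<bar>)"
      proof (rule sum_mono)
        fix j
        have "bump (?u l) \<le> 1" by (rule order.trans[OF bump_le_plateau plateau_le_1])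
        then have "pass j l + sense j l * bump (?u l) \<le> pass j l + sense j l"
          using sense_nonneg[of j l] mult_left_mono[of "bump (?u l)" 1 "sense j l"] by simp
        moreover have "0 \<le> pass j l + sense j l * bump (?u l)"
          using pass_nonneg[of j l] sense_nonneg[of j l] bump_nonneg by simp
        ultimately show "\<bar>coord ?\<eta> j * (pass j l + sense j l * bump (?u l))\<bar>
            \<le> (pass j l + sense j l) * \<bar>coord ?\<eta> j\<bar>"
          by (subst abs_mult, subst mult.commute) (simp add: mult_right_mono)
      qed
      also have "\<dots> = coord ?V l" using l by simp
      finally show "\<bar>coord A l\<bar> \<le> \<bar>coord ?V l\<bar>" by linarith
    qed (simp_all add: A_def)
    also have "norm ?V \<le> 2 * norm ?\<eta>" by (rule coupling_norm(2)[OF \<eta>]) simp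
    finally show "norm A \<le> 2 * norm ?\<eta>" .
    show "norm (mk_vec T (coord ?\<eta>)) \<le> 1 * norm ?\<eta>" by (rule norm_mk_vec_le[OF \<eta>]) auto
    show "norm B \<le> L / 6 * norm ?\<delta>"
      unfolding B_def
    proof (rule norm_mk_vec_le[OF \<delta> order.refl])
      fix l assume l: "l < T"
      have "\<bar>\<Sum>j<T. coord y' j * (sense j l * (bump (?u l) - bump (?v l)))\<bar>
          \<le> (\<Sum>j<T. sense j l * (cap * (\<bar>coord ?\<delta> l\<bar> / a)))"
      proof (rule order.trans[OF sum_abs], rule sum_mono)
        fix j assume "j \<in> {..<T}"
        then have "\<bar>coord y' j\<bar> \<le> cap" using y(2) by (auto simp: Y_def)
        moreover have "\<bar>bump (?u l) - bump (?v l)\<bar> \<le> \<bar>coord ?\<delta> l\<bar> / a"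
          using bump_lipschitz[of "?u l" "?v l"] by (simp only: uv)
        ultimately have "\<bar>coord y' j\<bar> * \<bar>bump (?u l) - bump (?v l)\<bar> \<le> cap * (\<bar>coord ?\<delta> l\<bar> / a)"
          using cap_pos by (intro mult_mono) auto
        then have "sense j l * (\<bar>coord y' j\<bar> * \<bar>bump (?u l) - bump (?v l)\<bar>)
            \<le> sense j l * (cap * (\<bar>coord ?\<delta> l\<bar> / a))"
          by (rule mult_left_mono[OF _ sense_nonneg])
        moreover have "\<bar>coord y' j * (sense j l * (bump (?u l) - bump (?v l)))\<bar>
            = sense j l * (\<bar>coord y' j\<bar> * \<bar>bump (?u l) - bump (?v l)\<bar>)"
          using sense_nonneg[of j l] by (simp add: abs_mult)
        ultimately show "\<bar>coord y' j * (sense j l * (bump (?u l) - bump (?v l)))\<bar>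
            \<le> sense j l * (cap * (\<bar>coord ?\<delta> l\<bar> / a))" by simp
      qed
      also have "\<dots> = (\<Sum>j<T. sense j l) * (cap * (\<bar>coord ?\<delta> l\<bar> / a))"
        by (rule sum_distrib_right[symmetric])
      also have "\<dots> \<le> 1 / real n * (cap * (\<bar>coord ?\<delta> l\<bar> / a))"
        using cap_pos a_pos by (intro mult_right_mono sense_col_sum) simp
      finally have "\<bar>\<kappa> * (\<Sum>j<T. coord y' j * (sense j l * (bump (?u l) - bump (?v l))))\<bar>
          \<le> \<kappa> * (1 / real n * (cap * (\<bar>coord ?\<delta> l\<bar> / a)))"
        unfolding abs_mult[of \<kappa>] abs_of_pos[OF kappa_pos]
        by (rule mult_left_mono[OF _ less_imp_le[OF kappa_pos]])
      also have "\<dots> = (\<kappa> * cap) / (real n * a) * \<bar>coord ?\<delta> l\<bar>" by simp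
      also have "(\<kappa> * cap) / (real n * a) = L / 6"
        unfolding kappa_cap a_def using n_pos b_pos L_pos by (simp add: field_simps)
      finally show "\<bar>\<kappa> * (\<Sum>j<T. coord y' j * (sense j l * (bump (?u l) - bump (?v l))))\<bar>
          \<le> L / 6 * \<bar>coord ?\<delta> l\<bar>" .
    qed (use L_pos in simp)
    show "norm P \<le> L / 4 * norm ?\<delta>"
      unfolding P_def
    proof (rule norm_mk_vec_le[OF \<delta> order.refl])
      fix l
      have "\<bar>3 * b * (plateau (?u l) - plateau (?v l))\<bar> \<le> 3 * b * (\<bar>coord ?\<delta> l\<bar> / a)"
        using mult_left_mono[OF plateau_lipschitz[of "?u l" "?v l"], of "3 * b"] b_pos
        unfolding uv by (simp add: abs_mult)
      also have "\<dots> = 3 * b / a * \<bar>coord ?\<delta> l\<bar>" by simp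
      also have "3 * b / a = L / 4" using b_pos L_pos by (simp add: a_def)
      finally show "\<bar>3 * b * (plateau (?u l) - plateau (?v l))\<bar> \<le> L / 4 * \<bar>coord ?\<delta> l\<bar>" .
    qed (use L_pos in simp)
  qed (use kappa_pos in auto)
  finally show ?thesis by (simp add: \<kappa>_def algebra_simps)
qed

lemma inner_res: "inner y (res x) = (\<Sum>j<T. coord y j * (\<kappa> * (drive x j - coord x j)))"
  by (subst inner_commute) (simp add: res_def inner_mk_vec mult_ac)

lemma drive_has_derivative:
  "((\<lambda>x. drive x j) has_derivative
     (\<lambda>v. \<Sum>l<T. (pass j l + sense j l * bump (coord x l / a)) * coord v l)) (at x)"
proof -
  have s: "((\<lambda>x. a * switch (coord x l / a)) has_derivative (\<lambda>v. bump (coord x l / a) * coord v l)) (at x)"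
    for l
  proof -
    have "((\<lambda>t. t / a) has_real_derivative 1 / a) (at t)" for t
      using a_pos by (auto intro!: derivative_eq_intros)
    from DERIV_cmult[OF DERIV_chain2[OF switch_deriv this], of a]
    have "((\<lambda>t. a * switch (t / a)) has_real_derivative bump (t / a)) (at t)" for t
      using a_pos by simp
    from has_derivative_compose[OF coord_has_derivative[OF has_derivative_ident]
        has_field_derivative_imp_has_derivative[OF this]]
    show ?thesis .
  qed
  have "((\<lambda>x. drive x j) has_derivative
     (\<lambda>v. 0 + (\<Sum>l<T. pass j l * coord v l + sense j l * (bump (coord x l / a) * coord v l)))) (at x)"
    unfolding drive_def
    by (intro has_derivative_add has_derivative_const has_derivative_sum has_derivative_mult_right
        s coord_has_derivative has_derivative_ident)
  then show ?thesis by (simp add: distrib_right mult.assoc)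
qed

lemma pot_has_derivative:
  "(pot has_derivative (\<lambda>v. - (\<Sum>l<T. 3 * b * (plateau (coord x l / a) * coord v l)))) (at x)"
proof -
  have s: "((\<lambda>x. a * slide (coord x l / a)) has_derivative (\<lambda>v. plateau (coord x l / a) * coord v l)) (at x)"
    for l
  proof -
    have "((\<lambda>t. t / a) has_real_derivative 1 / a) (at t)" for t
      using a_pos by (auto intro!: derivative_eq_intros)
    from DERIV_cmult[OF DERIV_chain2[OF slide_deriv this], of a]
    have "((\<lambda>t. a * slide (t / a)) has_real_derivative plateau (t / a)) (at t)" for t
      using a_pos by simp
    from has_derivative_compose[OF coord_has_derivative[OF has_derivative_ident]
        has_field_derivative_imp_has_derivative[OF this]]
    show ?thesis .
  qed
  show ?thesis
    unfolding pot_def[abs_def]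
    by (intro has_derivative_minus has_derivative_sum has_derivative_mult_right s)
qed

lemma objective_has_derivative:
  "(objective I has_derivative (\<lambda>h. inner (gx x y, res x) h)) (at (x, y))"
proof -
  let ?W = "\<lambda>j l. pass j l + sense j l * bump (coord x l / a)"
  have fst': "(fst has_derivative fst) (at (x, y))" and snd': "(snd has_derivative snd) (at (x, y))"
    for x y :: fvec
    using has_derivative_fst[OF has_derivative_ident] has_derivative_snd[OF has_derivative_ident] .
  have obj: "objective I = (\<lambda>z. (\<Sum>j<T. coord (snd z) j * (\<kappa> * (drive (fst z) j - coord (fst z) j)))
      + pot (fst z))"
    by (rule ext) (auto simp: I_def inner_res)
  have der: "((\<lambda>z. (\<Sum>j<T. coord (snd z) j * (\<kappa> * (drive (fst z) j - coord (fst z) j)))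
      + pot (fst z)) has_derivative
    (\<lambda>h. (\<Sum>j<T. coord (snd (x, y)) j * (\<kappa> * ((\<Sum>l<T. ?W j l * coord (fst h) l) - coord (fst h) j))
        + coord (snd h) j * (\<kappa> * (drive (fst (x, y)) j - coord (fst (x, y)) j)))
      + - (\<Sum>l<T. 3 * b * (plateau (coord x l / a) * coord (fst h) l)))) (at (x, y))"
    by (intro has_derivative_add has_derivative_sum has_derivative_mult has_derivative_mult_right
        has_derivative_diff coord_has_derivative fst' snd'
        has_derivative_compose[OF fst', where g = "\<lambda>x. drive x _"]
        has_derivative_compose[OF fst', where g = pot])
      (simp_all add: drive_has_derivative pot_has_derivative)
  have adj: "(\<Sum>j<T. coord y j * (\<kappa> * ((\<Sum>l<T. ?W j l * coord u l) - coord u j))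
        + coord v j * (\<kappa> * (drive x j - coord x j)))
      + - (\<Sum>l<T. 3 * b * (plateau (coord x l / a) * coord u l))
      = inner (gx x y) u + inner (res x) v" for u v
  proof -
    have "(\<Sum>j<T. coord y j * (\<Sum>l<T. ?W j l * coord u l))
        = (\<Sum>l<T. (\<Sum>j<T. coord y j * ?W j l) * coord u l)"
      unfolding sum_distrib_left sum_distrib_right by (subst sum.swap) (simp only: mult.assoc)
    then have "\<kappa> * (\<Sum>j<T. coord y j * (\<Sum>l<T. ?W j l * coord u l))
        = \<kappa> * (\<Sum>l<T. (\<Sum>j<T. coord y j * ?W j l) * coord u l)"
      by (rule arg_cong)
    then have swap: "(\<Sum>j<T. \<kappa> * (coord y j * (\<Sum>l<T. ?W j l * coord u l)))
        = (\<Sum>l<T. \<kappa> * ((\<Sum>j<T. coord y j * ?W j l) * coord u l))"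
      by (simp only: sum_distrib_left)
    have 1: "(\<Sum>j<T. coord y j * (\<kappa> * ((\<Sum>l<T. ?W j l * coord u l) - coord u j))
        + coord v j * (\<kappa> * (drive x j - coord x j)))
      = (\<Sum>j<T. \<kappa> * (coord y j * (\<Sum>l<T. ?W j l * coord u l)))
        - (\<Sum>j<T. \<kappa> * (coord y j * coord u j)) + (\<Sum>j<T. coord v j * (\<kappa> * (drive x j - coord x j)))"
      unfolding sum_subtractf[symmetric] sum.distrib[symmetric]
      by (rule sum.cong) (simp_all add: right_diff_distrib mult.left_commute)
    have 2: "(\<Sum>j<T. \<kappa> * (coord y j * (\<Sum>l<T. ?W j l * coord u l)))
        - (\<Sum>j<T. \<kappa> * (coord y j * coord u j)) + (\<Sum>j<T. coord v j * (\<kappa> * (drive x j - coord x j)))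
        - (\<Sum>l<T. 3 * b * (plateau (coord x l / a) * coord u l))
      = (\<Sum>l<T. (\<kappa> * ((\<Sum>j<T. coord y j * ?W j l) - coord y l) - 3 * b * plateau (coord x l / a)) * coord u l)
        + (\<Sum>j<T. \<kappa> * (drive x j - coord x j) * coord v j)"
      unfolding swap sum_subtractf[symmetric] sum.distrib[symmetric]
      by (rule sum.cong) (simp_all add: left_diff_distrib right_diff_distrib mult_ac)
    show ?thesis
      unfolding gx_def res_def inner_mk_vec add_uminus_conv_diff 1 by (rule 2)
  qed
  show ?thesis
    unfolding obj inner_prod_def fst_conv snd_conv adj[symmetric] using der unfolding fst_conv snd_conv .
qed

lemma euclid_mono: "d \<le> e \<Longrightarrow> euclid d \<subseteq> euclid e"
  by (auto simp: euclid_def)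

lemma grad_I:
  assumes "x \<in> euclid T" "y \<in> euclid (Suc T)"
  shows "grad I (x, y) = (gx x y, res x)"
proof -
  have "res x \<in> euclid (Suc T)"
    using euclid_mono[of T "Suc T"] by (auto simp: res_def)
  then have g: "is_gradient_on (amb I) (objective I) (x, y) (gx x y, res x)"
    using objective_has_derivative
    by (auto simp: is_gradient_on_def gx_def intro: has_derivative_at_withinI)
  have "subspace (amb I)" by (intro subspace_Times subspace_euclid)
  moreover have "(x, y) \<in> amb I" using assms by simp
  ultimately show ?thesis
    unfolding grad_def gradient_on_def
    using g is_gradient_on_unique by (intro the_equality) blast+
qed

lemma Y_eq: "Y = euclid (Suc T) \<inter> cball 0 (D / 2) \<inter> (\<Inter>j\<in>{..<T}. (\<lambda>y. coord y j) -` {0..cap})"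
  by (auto simp: Y_def)

lemma Y_closed: "closed Y"
  unfolding Y_eq
  by (intro closed_Int closed_euclid closed_cball closed_INT ballI closed_vimage closed_atLeastAtMost
      coord_continuous continuous_on_id)

lemma Y_convex: "convex Y"
  unfolding Y_eq
  by (intro convex_Int convex_cball convex_INT subspace_imp_convex[OF subspace_euclid]
      convex_linear_vimage bounded_linear.linear[OF bounded_linear_coord] convex_real_interval)

lemma Y_subset: "Y \<subseteq> euclid (Suc T)" by (auto simp: Y_def)

lemma Y_bounded: "bounded Y"
  by (rule bounded_subset[OF bounded_cball[of 0 "D / 2"]]) (auto simp: Y_def)

lemma Y_compact: "compact Y"
  by (rule compact_euclid[OF Y_closed Y_subset Y_bounded])

lemma zero_in_Y: "0 \<in> Y"
  using D_pos cap_pos by (simp add: Y_def)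

lemma Y_diameter: "diameter Y = D"
proof (rule antisym)
  show "diameter Y \<le> D"
  proof (rule diameter_le)
    show "norm (y - y') \<le> D" if "y \<in> Y" "y' \<in> Y" for y y'
      using that norm_triangle_ineq4[of y y'] by (auto simp: Y_def)
  qed (use D_pos in auto)
  define e where "e s = mk_vec (Suc T) (\<lambda>i. if i = T then s * D / 2 else 0)" for s :: real
  have ne: "norm (e s) = \<bar>s * D / 2\<bar>" for s
  proof -
    have "(\<Sum>i<T. (coord (e s) i)\<^sup>2) = 0"
      by (rule sum.neutral) (auto simp: e_def)
    then have "(norm (e s))\<^sup>2 = (s * D / 2)\<^sup>2"
      using norm_euclid[of "e s" "Suc T"] by (simp add: e_def)
    then have "sqrt ((norm (e s))\<^sup>2) = sqrt ((s * D / 2)\<^sup>2)" by (rule arg_cong)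
    then show ?thesis by (simp only: real_sqrt_abs abs_norm_cancel)
  qed
  have "e 1 \<in> Y" "e (-1) \<in> Y"
    using ne[of 1] ne[of "-1"] D_pos cap_pos by (auto simp: Y_def) (auto simp: e_def)
  moreover have "e 1 - e (-1) = e 2"
    by (rule fvec_eqI) (auto simp: e_def)
  ultimately show "D \<le> diameter Y"
    using diameter_bounded_bound[OF Y_bounded, of "e 1" "e (-1)"] ne[of 2] D_pos
    by (simp add: dist_norm)
qed

lemma objective_le_primal:
  assumes "y \<in> Y" shows "inner y (res x) + pot x \<le> primal I x"
proof -
  have "bdd_above ((\<lambda>y. objective I (x, y)) ` Y)"
  proof (rule bdd_aboveI2)
    fix y assume "y \<in> Y"
    then have "norm y * norm (res x) \<le> D / 2 * norm (res x)"
      by (intro mult_right_mono) (auto simp: Y_def)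
    then show "objective I (x, y) \<le> D / 2 * norm (res x) + pot x"
      using norm_cauchy_schwarz[of y "res x"] by simp
  qed
  then show ?thesis using cSUP_upper[OF assms] by (auto simp: primal_def)
qed

lemma primal_le:
  assumes "\<And>y. y \<in> Y \<Longrightarrow> inner y (res x) \<le> B"
  shows "primal I x \<le> B + pot x"
  using zero_in_Y assms by (auto simp: primal_def intro!: cSUP_least)

lemma pot_lower: "pot x \<ge> - (216 * real M * \<epsilon>\<^sup>2 / L)"
proof -
  have "(\<Sum>l<T. 3 * b * (a * slide (coord x l / a))) \<le> (\<Sum>l<T. 3 * b * (a * 3))"
    using a_pos b_pos slide_le_3 by (intro sum_mono mult_left_mono) auto
  also have "\<dots> = 216 * real M * (real n * b\<^sup>2) / L"
    by (simp add: T_def a_def power2_eq_square)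
  finally show ?thesis by (simp add: pot_def n_b_squared)
qed

lemma primal_zero_le: "primal I 0 \<le> 24 * \<epsilon>\<^sup>2 / L"
proof -
  have "inner y (res 0) \<le> 24 * \<epsilon>\<^sup>2 / L" if y: "y \<in> Y" for y
  proof -
    have T: "0 < T" using n_pos M_pos by (simp add: T_def)
    have "drive 0 j = (if j = 0 then a else 0)" for j
      by (simp add: drive_def switch_eq_0)
    then have "inner y (res 0) = (\<Sum>j<T. if j = 0 then \<kappa> * a * coord y 0 else 0)"
      unfolding inner_res by (intro sum.cong) auto
    also have "\<dots> = \<kappa> * a * coord y 0" using T by simp
    also have "\<dots> \<le> \<kappa> * a * cap"
      using y T kappa_pos a_pos by (intro mult_left_mono) (auto simp: Y_def)
    also have "\<dots> = a * (\<kappa> * cap)" by simp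
    also have "\<dots> = 24 * (real n * b\<^sup>2) / L"
      unfolding kappa_cap by (simp add: a_def power2_eq_square)
    finally show ?thesis by (simp add: n_b_squared)
  qed
  then have "primal I 0 \<le> 24 * \<epsilon>\<^sup>2 / L + pot 0" by (rule primal_le)
  also have "pot 0 = 0" by (simp add: pot_def slide_0)
  finally show ?thesis by simp
qed

lemma grad_lipschitz:
  assumes "z \<in> euclid T \<times> Y" "z' \<in> euclid T \<times> Y"
  shows "norm (grad I z - grad I z') \<le> L * norm (z - z')"
proof -
  obtain x y x' y' where z: "z = (x, y)" "z' = (x', y')" by (metis surj_pair)
  have x: "x \<in> euclid T" "x' \<in> euclid T" and y: "y \<in> Y" "y' \<in> Y" using assms z by auto
  have "norm (grad I z - grad I z') = norm (gx x y - gx x' y', res x - res x')"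
    using x subsetD[OF Y_subset y(1)] subsetD[OF Y_subset y(2)] by (simp add: z grad_I)
  also have "\<dots> \<le> norm (gx x y - gx x' y') + norm (res x - res x')"
    by (rule norm_Pair_le)
  also have "\<dots> \<le> L / 4 * norm (y - y') + 5 / 12 * L * norm (x - x') + L / 4 * norm (x - x')"
    by (intro add_mono gx_lipschitz res_lipschitz x y)
  also have "\<dots> \<le> L / 4 * norm (z - z') + 5 / 12 * L * norm (z - z') + L / 4 * norm (z - z')"
    using norm_fst_le[of "x - x'" "y - y'"] norm_snd_le[of "y - y'" "x - x'"] L_pos
    by (intro add_mono mult_left_mono) (auto simp: z)
  also have "\<dots> \<le> L * norm (z - z')"
    using mult_nonneg_nonneg[of L "norm (z - z')"] L_pos by simp
  finally show ?thesis .
qed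

text \<open>
  The term \<open>24 * \<epsilon>\<^sup>2 / L\<close> is the penalty of the origin for the constant first drive; the other one
  bounds the total decrease of the potential.
\<close>

lemma I_in_NCC:
  assumes "(24 + 216 * real M) * \<epsilon>\<^sup>2 / L \<le> \<Delta>"
  shows "I \<in> NCC L \<Delta> D"
proof -
  have diff: "objective I differentiable (at z within euclid T \<times> euclid (Suc T))" for z
    using objective_has_derivative[of "fst z" "snd z"]
    by (auto intro: has_derivative_at_withinI differentiableI)
  have "L-lipschitz_on (euclid T \<times> Y) (grad I)"
    using L_pos grad_lipschitz by (intro lipschitz_onI) (auto simp: dist_norm)
  then have cont: "continuous_on (euclid T \<times> Y) (grad I)"
    by (rule lipschitz_on_continuous_on)
  have conc: "concave_on Y (\<lambda>y. objective I (x, y))" for x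
    unfolding concave_on_def convex_on_def
    by (auto simp: Y_convex inner_add_left algebra_simps simp flip: distrib_right)
  have low: "- (216 * real M * \<epsilon>\<^sup>2 / L) \<le> primal I x" for x
    using objective_le_primal[OF zero_in_Y, of x] pot_lower[of x] by simp
  have "- (216 * real M * \<epsilon>\<^sup>2 / L) \<le> (INF x\<in>euclid T. primal I x)"
    using zero_in_euclid[of T] by (intro cINF_greatest low) blast
  then have "primal I 0 - (INF x\<in>euclid T. primal I x)
      \<le> 24 * \<epsilon>\<^sup>2 / L + 216 * real M * \<epsilon>\<^sup>2 / L"
    using primal_zero_le by simp
  also have "\<dots> = (24 + 216 * real M) * \<epsilon>\<^sup>2 / L"
    by (simp add: distrib_right add_divide_distrib)
  also note assms
  finally have gap: "primal I 0 - (INF x\<in>euclid T. primal I x) \<le> \<Delta>" .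
  have "bdd_below (primal I ` euclid T)" by (rule bdd_belowI2[OF low])
  moreover have "\<forall>z\<in>euclid T \<times> Y. \<forall>z'\<in>euclid T \<times> Y.
      norm (grad I z - grad I z') \<le> L * norm (z - z')"
    by (blast intro: grad_lipschitz)
  ultimately show ?thesis
    unfolding NCC_def mem_Collect_eq I_simps(1-4)
    by (intro conjI ballI order.refl closed_euclid subspace_imp_convex[OF subspace_euclid]
        zero_in_euclid Y_subset Y_closed Y_convex zero_in_Y diff cont conc gap Y_bounded
        eq_refl[OF Y_diameter]) auto
qed

section \<open>The chain is revealed slowly\<close>

text \<open>
  \<open>depth j\<close> bounds from below the number of oracle calls before coordinate \<open>j\<close> can be nonzero. Each
  block counts only \<open>n\<close>, since the next block can be entered from the first sensor on.
\<close>

definition depth :: "nat \<Rightarrow> nat" where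
  "depth j = n * (j div (2 * n)) + j mod (2 * n)"

definition revealed :: "nat \<Rightarrow> nat set" where
  "revealed t = {j. j < T \<and> depth j < t}"

lemma revealed_mono: "s \<le> t \<Longrightarrow> revealed s \<subseteq> revealed t"
  by (auto simp: revealed_def)

lemma depth_Suc:
  assumes "Suc l mod (2 * n) \<noteq> 0" shows "depth (Suc l) = Suc (depth l)"
  using assms by (simp add: depth_def mod_Suc div_Suc split: if_splits)

lemma depth_block: "i < 2 * n \<Longrightarrow> depth (2 * n * m + i) = n * m + i"
  by (simp add: depth_def)

lemma depth_sensor:
  assumes "j mod (2 * n) = 0" "l < j" "j \<le> l + n" shows "depth j \<le> depth l"
proof -
  obtain q where q: "j = 2 * n * q" using assms(1) by (auto simp: mod_eq_0_iff_dvd elim!: dvdE)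
  with assms obtain m where m: "q = Suc m" by (cases q) auto
  define i where "i = l - 2 * n * m"
  have l: "l = 2 * n * m + i" "i < 2 * n" "n \<le> i"
    using assms q m by (auto simp: i_def)
  have "depth j = n * q" using depth_block[of 0 q] n_pos q by simp
  also have "\<dots> \<le> depth l" unfolding l(1) depth_block[OF l(2)] using l(3) m by simp
  finally show ?thesis .
qed

lemma coord_not_revealed: "supp x \<subseteq> revealed t \<Longrightarrow> t \<le> depth j \<Longrightarrow> coord x j = 0"
  by (auto simp: supp_def revealed_def)

lemma supp_res:
  assumes x: "supp x \<subseteq> revealed t" shows "supp (res x) \<subseteq> revealed (Suc t)"
proof
  fix j assume j: "j \<in> supp (res x)"
  then have jT: "j < T" and ne: "drive x j - coord x j \<noteq> 0"
    by (auto simp: supp_def res_def split: if_splits)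
  show "j \<in> revealed (Suc t)"
  proof (rule ccontr)
    assume "\<not> ?thesis"
    then have d: "Suc t \<le> depth j" using jT by (auto simp: revealed_def)
    then have j0: "j \<noteq> 0" by (cases "j = 0") (auto simp: depth_def)
    have "pass j l * coord x l + sense j l * (a * switch (coord x l / a)) = 0" for l
    proof -
      have "coord x l = 0" if "pass j l \<noteq> 0 \<or> sense j l \<noteq> 0"
      proof (rule coord_not_revealed[OF x])
        show "t \<le> depth l"
          using that d depth_Suc[of l] depth_sensor[of j l]
          by (auto simp: pass_def sense_def split: if_splits)
      qed
      then show ?thesis by (cases "pass j l = 0 \<and> sense j l = 0") (simp_all add: switch_eq_0)
    qed
    then have "drive x j = 0" using j0 by (simp add: drive_def)
    moreover have "coord x j = 0" using coord_not_revealed[OF x] d by simp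
    ultimately show False using ne by simp
  qed
qed

text \<open>
  Along the sensor terms nothing is passed on from \<open>y\<close> to \<open>x\<close>, since \<open>bump\<close> vanishes at a zero
  coordinate; a new primal coordinate is revealed only by the dual coordinate of the same or of the
  next index.
\<close>

lemma supp_gx:
  assumes x: "supp x \<subseteq> revealed t" and y: "supp y \<subseteq> revealed t"
  shows "supp (gx x y) \<subseteq> revealed (Suc t)"
proof
  fix l assume l: "l \<in> supp (gx x y)"
  then have lT: "l < T" by (auto simp: supp_def gx_def split: if_splits)
  show "l \<in> revealed (Suc t)"
  proof (rule ccontr)
    assume "\<not> ?thesis"
    then have d: "Suc t \<le> depth l" using lT by (auto simp: revealed_def)
    have 0: "coord x l = 0" "coord y l = 0"
      using coord_not_revealed[OF x] coord_not_revealed[OF y] d by simp_all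
    have "coord y j * (pass j l + sense j l * bump (coord x l / a)) = 0" for j
    proof -
      have "coord y j = 0" if "pass j l \<noteq> 0"
        using that d depth_Suc[of l]
        by (intro coord_not_revealed[OF y]) (auto simp: pass_def split: if_splits)
      then show ?thesis using 0 by (cases "pass j l = 0") (simp_all add: bump_eq)
    qed
    then have "(\<Sum>j<T. coord y j * (pass j l + sense j l * bump (coord x l / a))) = 0"
      by (intro sum.neutral) blast
    then have "coord (gx x y) l = 0" using 0 by (simp add: gx_def plateau_eq)
    then show False using l by (simp add: supp_def)
  qed
qed

lemma supp_revealed_euclid: "supp x \<subseteq> revealed t \<Longrightarrow> x \<in> euclid T"
  by (auto simp: euclid_def revealed_def)

lemma Y_delete:
  assumes "y \<in> Y" shows "mk_vec (Suc T) (\<lambda>i. if i \<in> S then coord y i else 0) \<in> Y"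
proof -
  have "norm (mk_vec (Suc T) (\<lambda>i. if i \<in> S then coord y i else 0)) \<le> norm y"
    using assms by (intro norm_le_coordwise[of _ "Suc T"]) (auto simp: Y_def)
  then show ?thesis using assms cap_pos by (auto simp: Y_def)
qed

lemma supp_oracle:
  assumes "supp (fst z) \<subseteq> revealed t" "supp (snd z) \<subseteq> revealed t"
  shows "supp (gradx I z) \<subseteq> revealed (Suc t)" and "supp (grady I z) \<subseteq> revealed (Suc t)"
proof -
  have "fst z \<in> euclid T" "snd z \<in> euclid (Suc T)"
    using assms supp_revealed_euclid euclid_mono[of T "Suc T"] by auto
  then have "grad I z = (gx (fst z) (snd z), res (fst z))"
    using grad_I[of "fst z" "snd z"] by simp
  then show "supp (gradx I z) \<subseteq> revealed (Suc t)" "supp (grady I z) \<subseteq> revealed (Suc t)"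
    using supp_gx supp_res assms by (simp_all add: gradx_def grady_def)
qed

lemma supp_zr_primal:
  assumes it: "\<And>i. i < q \<Longrightarrow> supp (fst (iterate A I i)) \<subseteq> revealed i \<and> supp (snd (iterate A I i)) \<subseteq> revealed i"
    and x: "zr_primal A I q x"
  shows "supp x \<subseteq> revealed q"
proof -
  obtain u where u: "supp u \<subseteq> (\<Union>i<q. supp (fst (iterate A I i)) \<union> supp (gradx I (iterate A I i)))"
    and xu: "x = proj (euclid T) u"
    using x by (auto simp: zr_primal_def)
  have "supp (fst (iterate A I i)) \<union> supp (gradx I (iterate A I i)) \<subseteq> revealed q" if "i < q" for i
    using it[OF that] supp_oracle[of "iterate A I i" i] revealed_mono[of i q] revealed_mono[of "Suc i" q] that
    by auto
  with u have su: "supp u \<subseteq> revealed q" by blast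
  then show ?thesis using xu proj_self[OF supp_revealed_euclid[OF su]] by simp
qed

lemma supp_zr_dual:
  assumes it: "\<And>i. i < q \<Longrightarrow> supp (fst (iterate A I i)) \<subseteq> revealed i \<and> supp (snd (iterate A I i)) \<subseteq> revealed i"
    and y: "zr_dual A I q y"
  shows "supp y \<subseteq> revealed q"
proof -
  obtain v where v: "supp v \<subseteq> (\<Union>i<q. supp (snd (iterate A I i)) \<union> supp (grady I (iterate A I i)))"
    and yv: "y = proj Y v"
    using y by (auto simp: zr_dual_def)
  have "supp (snd (iterate A I i)) \<union> supp (grady I (iterate A I i)) \<subseteq> revealed q" if "i < q" for i
    using it[OF that] supp_oracle[of "iterate A I i" i] revealed_mono[of i q] revealed_mono[of "Suc i" q] that
    by auto
  with v have sv: "supp v \<subseteq> revealed q" by blast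
  then have "v \<in> euclid (Suc T)" using supp_revealed_euclid euclid_mono[of T "Suc T"] by auto
  then have "supp (proj Y v) \<subseteq> supp v"
    using Y_compact zero_in_Y Y_subset Y_delete by (intro supp_proj_subset[of _ "Suc T"]) auto
  with sv yv show ?thesis by simp
qed

lemma supp_iterate:
  assumes "zero_respecting_on A I"
  shows "supp (fst (iterate A I t)) \<subseteq> revealed t \<and> supp (snd (iterate A I t)) \<subseteq> revealed t"
proof (induction t rule: less_induct)
  case (less t)
  show ?case
  proof (cases t)
    case 0
    then show ?thesis using assms by (simp add: zero_respecting_on_def supp_def)
  next
    case (Suc s)
    have "zr_primal A I t (fst (iterate A I t))" "zr_dual A I t (snd (iterate A I t))"
      using assms Suc by (auto simp: zero_respecting_on_def)
    then show ?thesis using supp_zr_primal supp_zr_dual less by blast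
  qed
qed

section \<open>Near-stationary points have a completed chain\<close>

lemma sum_blocks: "(\<Sum>j<T. f j) = (\<Sum>m<M. \<Sum>i<2 * n. f (2 * n * m + i))" for f :: "nat \<Rightarrow> real"
  using sum_mult_product[of f M "2 * n"] by (simp add: T_def ac_simps)

lemma block_index_less:
  assumes "m < M" "i < 2 * n" shows "2 * n * m + i < T"
proof -
  have "2 * n * m + i < 2 * n * Suc m" using assms by simp
  also have "\<dots> \<le> 2 * n * M" using assms by (intro mult_le_mono2) simp
  finally show ?thesis by (simp add: T_def)
qed

lemma block_index_Suc_mod:
  assumes "i < 2 * n" shows "Suc (2 * n * m + i) mod (2 * n) = 0 \<longleftrightarrow> Suc i = 2 * n"
proof -
  have "Suc (2 * n * m + i) mod (2 * n) = Suc i mod (2 * n)"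
    using mod_mult_self4[of "2 * n" m "Suc i"] by simp
  then show ?thesis using assms by (cases "Suc i = 2 * n") auto
qed

lemma drive_0: "drive x 0 = a"
proof -
  have "pass 0 l * coord x l + sense 0 l * (a * switch (coord x l / a)) = 0" for l
    by (simp add: pass_def sense_def)
  then show ?thesis by (simp add: drive_def)
qed

lemma drive_inside:
  assumes "Suc j mod (2 * n) \<noteq> 0" "Suc j < T" shows "drive x (Suc j) = coord x j"
proof -
  have "pass (Suc j) l * coord x l + sense (Suc j) l * (a * switch (coord x l / a))
      = (if l = j then coord x j else 0)" for l
    using assms by (simp add: pass_def sense_def)
  then show ?thesis using assms by (simp add: drive_def)
qed

lemma drive_block_start:
  assumes m: "Suc m < M" and x: "\<And>i. n \<le> i \<Longrightarrow> i < 2 * n \<Longrightarrow> coord x (2 * n * m + i) \<ge> 3 * a"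
  shows "drive x (2 * n * Suc m) = a"
proof -
  let ?j = "2 * n * Suc m" and ?S = "{2 * n * m + n..<2 * n * Suc m}"
  have jT: "?j < T" using block_index_less[OF m, of 0] n_pos by simp
  have j0: "?j \<noteq> 0" "?j mod (2 * n) = 0" using n_pos by simp_all
  have "(\<Sum>l<T. pass ?j l * coord x l + sense ?j l * (a * switch (coord x l / a)))
      = (\<Sum>l\<in>?S. a / real n)"
  proof (rule sum.mono_neutral_cong_right)
    show "?S \<subseteq> {..<T}" using jT by auto
    show "\<forall>l\<in>{..<T} - ?S. pass ?j l * coord x l + sense ?j l * (a * switch (coord x l / a)) = 0"
      using j0 by (auto simp: pass_def sense_def)
    fix l assume l: "l \<in> ?S"
    define i where "i = l - 2 * n * m"
    have i: "n \<le> i" "i < 2 * n" "l = 2 * n * m + i" using l by (auto simp: i_def)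
    have "coord x l / a \<ge> 3" using x[OF i(1,2)] i(3) a_pos by (simp add: pos_le_divide_eq)
    then have "switch (coord x l / a) = 1" by (rule switch_eq_1)
    moreover have "sense ?j l = 1 / real n" "pass ?j l = 0"
      using j0 l by (auto simp: sense_def pass_def)
    ultimately show "pass ?j l * coord x l + sense ?j l * (a * switch (coord x l / a)) = a / real n"
      by simp
  qed simp
  also have "\<dots> = a" using n_pos by simp
  finally show ?thesis using j0(1) by (simp only: drive_def if_False add_0)
qed

lemma coord_res: "coord (res x) j = (if j < T then \<kappa> * (drive x j - coord x j) else 0)"
  by (simp add: res_def)

text \<open>
  A switch that is turned on by raising a sensor raises the next drive and hence the penalty, with
  slope at most \<open>2 * b\<close>; the potential outweighs it with slope \<open>3 * b\<close> on the range of the switch.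
  What remains is a drift of at least \<open>b\<close> there. The multiplier is continued by zero behind the block.
\<close>

lemma gradient_block_bound:
  assumes y: "y \<in> Y" and m: "m < M" and i: "i < 2 * n"
  defines "u \<equiv> \<lambda>k. if k < 2 * n then coord y (2 * n * m + k) else 0"
  shows "coord (gx x y) (2 * n * m + i)
    \<le> \<kappa> * (u (Suc i) - u i) - b * plateau (coord x (2 * n * m + i) / a)"
proof -
  let ?l = "2 * n * m + i"
  let ?t = "coord x ?l / a"
  have l: "?l < T" by (rule block_index_less[OF m i])
  have "(\<Sum>j<T. coord y j * pass j ?l) = (\<Sum>j<T. if j = Suc ?l then u (Suc i) else 0)"
    using block_index_Suc_mod[OF i, of m] i by (intro sum.cong) (auto simp: pass_def u_def)
  also have "\<dots> = u (Suc i)"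
    using block_index_less[OF m, of "Suc i"] by (auto simp: u_def)
  finally have pass: "(\<Sum>j<T. coord y j * pass j ?l) = u (Suc i)" .
  have "(\<Sum>j<T. coord y j * sense j ?l) \<le> (\<Sum>j<T. cap * sense j ?l)"
    using y sense_nonneg by (intro sum_mono mult_right_mono) (auto simp: Y_def)
  also have "\<dots> \<le> cap * (1 / real n)"
    unfolding sum_distrib_left[symmetric] using cap_pos by (intro mult_left_mono sense_col_sum) simp
  finally have "\<kappa> * (\<Sum>j<T. coord y j * sense j ?l) \<le> \<kappa> * (cap * (1 / real n))"
    using kappa_pos by (intro mult_left_mono) auto
  also have "\<dots> = (\<kappa> * cap) / real n" by simp
  also have "\<dots> = 2 * b" unfolding kappa_cap using n_pos by simp
  finally have "\<kappa> * (\<Sum>j<T. coord y j * sense j ?l) * bump ?t \<le> 2 * b * bump ?t"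
    by (rule mult_right_mono[OF _ bump_nonneg])
  also have "\<dots> \<le> 2 * b * plateau ?t"
    using b_pos by (intro mult_left_mono bump_le_plateau) auto
  finally have sense: "\<kappa> * ((\<Sum>j<T. coord y j * sense j ?l) * bump ?t) \<le> 2 * b * plateau ?t"
    by (simp only: mult.assoc)
  have "(\<Sum>j<T. coord y j * (pass j ?l + sense j ?l * bump ?t))
      = (\<Sum>j<T. coord y j * pass j ?l) + (\<Sum>j<T. coord y j * sense j ?l) * bump ?t"
    unfolding sum_distrib_right sum.distrib[symmetric]
    by (rule sum.cong) (simp_all add: distrib_left)
  then have "coord (gx x y) ?l = \<kappa> * (u (Suc i) + (\<Sum>j<T. coord y j * sense j ?l) * bump ?t - u i)
      - 3 * b * plateau ?t"
    using l i by (simp add: gx_def pass u_def)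
  with sense show ?thesis by (simp only: right_diff_distrib distrib_left)
qed

lemma Y_bounds: "y \<in> Y \<Longrightarrow> j < T \<Longrightarrow> 0 \<le> coord y j \<and> coord y j \<le> cap"
  by (simp add: Y_def)

text \<open>
  If neither the cap at \<open>j\<close> nor the ball binds, \<open>y\<close> can be increased at \<open>j\<close>; the coordinate \<open>T\<close> may
  be cleared to make room in the ball because it does not influence the payoff.
\<close>

lemma dual_maximizer_residual:
  assumes y: "y \<in> Y" and ymax: "\<And>y'. y' \<in> Y \<Longrightarrow> inner y' (res p) \<le> inner y (res p)"
    and j: "j < T" and below_cap: "coord y j < cap" and ball: "(\<Sum>j<T. (coord y j)\<^sup>2) < (D / 2)\<^sup>2"
  shows "drive p j \<le> coord p j"
proof (rule ccontr)
  assume "\<not> ?thesis"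
  then have pos: "coord (res p) j > 0" using j kappa_pos by (simp add: coord_res)
  define S where "S = (\<Sum>j<T. (coord y j)\<^sup>2)"
  \<comment> \<open>the squared norm grows by \<open>(2 * y\<^sub>j + t) * t \<le> 3 * cap * t\<close>, which the second bound keeps within
    the slack of the ball\<close>
  define t where "t = min (cap - coord y j) (((D / 2)\<^sup>2 - S) / (3 * cap))"
  have t: "t > 0" using below_cap ball cap_pos by (simp add: t_def S_def)
  have t1: "coord y j + t \<le> cap" by (simp add: t_def)
  have "t \<le> ((D / 2)\<^sup>2 - S) / (3 * cap)" by (simp add: t_def)
  then have t2: "3 * cap * t \<le> (D / 2)\<^sup>2 - S" using cap_pos by (simp add: field_simps)
  define y' where "y' = mk_vec (Suc T) (\<lambda>k. if k = T then 0 else if k = j then coord y j + t else coord y k)"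
  have "(norm y')\<^sup>2 = (\<Sum>k<T. (coord y' k)\<^sup>2)"
    using norm_euclid[of y' "Suc T"] by (simp add: y'_def)
  also have "\<dots> = (\<Sum>k<T. (coord y k)\<^sup>2 + (if k = j then (coord y j + t)\<^sup>2 - (coord y j)\<^sup>2 else 0))"
    by (intro sum.cong) (auto simp: y'_def)
  also have "\<dots> = S + ((coord y j + t)\<^sup>2 - (coord y j)\<^sup>2)" using j by (simp add: sum.distrib S_def)
  also have "(coord y j + t)\<^sup>2 - (coord y j)\<^sup>2 = (2 * coord y j + t) * t"
    by (simp add: power2_eq_square algebra_simps)
  also have "\<dots> \<le> 3 * cap * t" using Y_bounds[OF y j] t t1 by (intro mult_right_mono) auto
  finally have "(norm y')\<^sup>2 \<le> (D / 2)\<^sup>2" using t2 by linarith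
  then have "norm y' \<le> D / 2" by (rule power2_le_imp_le) (use D_pos in simp)
  moreover have "0 \<le> coord y' k \<and> coord y' k \<le> cap" if "k < T" for k
    using Y_bounds[OF y that] Y_bounds[OF y j] t t1 that by (auto simp: y'_def)
  ultimately have "y' \<in> Y" by (simp add: Y_def) (simp add: y'_def)
  then have "inner y' (res p) \<le> inner y (res p)" by (rule ymax)
  moreover have "inner y' (res p) = inner y (res p) + t * coord (res p) j"
  proof -
    have "inner y' (res p) = (\<Sum>k<T. coord y' k * coord (res p) k)"
      by (simp add: inner_res coord_res)
    also have "\<dots> = (\<Sum>k<T. coord y k * coord (res p) k + (if k = j then t * coord (res p) j else 0))"
      by (intro sum.cong) (auto simp: y'_def distrib_right)
    also have "\<dots> = inner y (res p) + t * coord (res p) j"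
      using j by (simp add: sum.distrib inner_res coord_res)
    finally show ?thesis .
  qed
  ultimately show False using mult_pos_pos[OF t pos] by linarith
qed

lemma dual_maximizer_zero:
  assumes y: "y \<in> Y" and ymax: "\<And>y'. y' \<in> Y \<Longrightarrow> inner y' (res p) \<le> inner y (res p)"
    and j: "j < T" and lt: "drive p j < coord p j"
  shows "coord y j = 0"
proof (rule ccontr)
  assume "coord y j \<noteq> 0"
  then have yj: "coord y j > 0" using Y_bounds[OF y j] by simp
  have neg: "coord (res p) j < 0" using lt j kappa_pos by (simp add: coord_res mult_pos_neg)
  define y' where "y' = mk_vec (Suc T) (\<lambda>k. if k \<in> - {j} then coord y k else 0)"
  have "y' \<in> Y" unfolding y'_def by (rule Y_delete[OF y])
  then have "inner y' (res p) \<le> inner y (res p)" by (rule ymax)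
  moreover have "inner y' (res p) = inner y (res p) - coord y j * coord (res p) j"
  proof -
    have "inner y' (res p) = (\<Sum>k<T. coord y' k * coord (res p) k)"
      by (simp add: inner_res coord_res)
    also have "\<dots> = (\<Sum>k<T. coord y k * coord (res p) k - (if k = j then coord y j * coord (res p) j else 0))"
      by (intro sum.cong) (auto simp: y'_def)
    also have "\<dots> = inner y (res p) - coord y j * coord (res p) j"
      using j by (simp add: sum_subtractf inner_res coord_res)
    finally show ?thesis .
  qed
  ultimately show False using mult_pos_neg[OF yj neg] by linarith
qed

text \<open>
  Induction along the blocks: as long as a block is driven by \<open>a\<close>, at most \<open>n\<close> of its coordinates can
  stay below \<open>3 * a\<close>, because the prefix of those coordinates has an aggregate slope of at least
  \<open>b\<close> per coordinate, against the bound \<open>\<epsilon>\<close> on the norm and \<open>n * b\<^sup>2 = \<epsilon>\<^sup>2\<close>.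
\<close>

lemma near_stationary_completed:
  assumes y: "y \<in> Y" and ymax: "\<And>y'. y' \<in> Y \<Longrightarrow> inner y' (res p) \<le> inner y (res p)"
    and small: "norm (gx p y) \<le> \<epsilon>"
    and m: "m < M" and i: "n \<le> i" "i < 2 * n"
  shows "coord p (2 * n * m + i) \<ge> 3 * a"
proof -
  define g where "g m k = coord (gx p y) (2 * n * m + k)" for m k
  define u where "u m k = (if k < 2 * n then coord y (2 * n * m + k) else 0)" for m k
  define G where "G m = (\<Sum>k<2 * n. (g m k)\<^sup>2)" for m
  have g_le: "g m k \<le> \<kappa> * (u m (Suc k) - u m k) - b * plateau (coord p (2 * n * m + k) / a)"
    if "m < M" "k < 2 * n" for m k
    using gradient_block_bound[OF y that, of p] by (simp only: g_def u_def)
  have "gx p y \<in> euclid T" by (simp add: gx_def)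
  then have "(norm (gx p y))\<^sup>2 = (\<Sum>m<M. G m)"
    unfolding G_def g_def using norm_euclid sum_blocks[of "\<lambda>l. (coord (gx p y) l)\<^sup>2"] by simp
  moreover have "(norm (gx p y))\<^sup>2 \<le> \<epsilon>\<^sup>2" by (intro power_mono small) simp
  ultimately have sumG: "(\<Sum>m<M. G m) \<le> \<epsilon>\<^sup>2" by simp
  have G0: "G m \<ge> 0" for m by (simp add: G_def sum_nonneg)
  have G_le: "G m \<le> \<epsilon>\<^sup>2" if "m < M" for m
    using member_le_sum[of m "{..<M}" G] G0 sumG that by fastforce
  have y0: "0 \<le> coord y j \<and> coord y j \<le> cap" if "j < T" for j
    by (rule Y_bounds[OF y that])
  \<comment> \<open>discrete Hardy inequality: sum the decrements from \<open>k\<close> to the end of the block, where the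
    multiplier vanishes\<close>
  have hardy: "(\<kappa> * coord y (2 * n * m + k))\<^sup>2 \<le> 2 * real n * G m" if mk: "m < M" "k < 2 * n" for m k
  proof -
    have "\<kappa> * u m k \<le> \<kappa> * u m l + (\<Sum>j\<in>{k..<l}. \<bar>g m j\<bar>)" if "k \<le> l" "l \<le> 2 * n" for l
      using that
    proof (induction l rule: dec_induct)
      case (step l)
      have "0 \<le> b * plateau (coord p (2 * n * m + l) / a)"
        using b_pos order.trans[OF bump_nonneg bump_le_plateau] by (intro mult_nonneg_nonneg) auto
      with g_le[OF mk(1), of l] step show ?case by (simp add: right_diff_distrib)
    qed simp
    from this[of "2 * n"] mk have "\<kappa> * coord y (2 * n * m + k) \<le> (\<Sum>j\<in>{k..<2 * n}. \<bar>g m j\<bar>)"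
      by (simp add: u_def)
    also have "\<dots> \<le> (\<Sum>j<2 * n. \<bar>g m j\<bar>)" by (rule sum_mono2) auto
    finally have "(\<kappa> * coord y (2 * n * m + k))\<^sup>2 \<le> (\<Sum>j<2 * n. \<bar>g m j\<bar>)\<^sup>2"
      using y0[OF block_index_less[OF mk]] kappa_pos by (intro power_mono) auto
    also have "\<dots> \<le> (\<Sum>j<2 * n. \<bar>g m j\<bar>\<^sup>2) * real (card {..<2 * n})"
      by (rule sum_squared_le_sum_of_squares)
    finally show ?thesis by (simp add: G_def mult.commute)
  qed
  have block: "\<exists>m k. m < M \<and> k < 2 * n \<and> j = 2 * n * m + k" if "j < T" for j
  proof (intro exI conjI)
    show "j div (2 * n) < M" using that by (simp add: T_def div_less_iff_less_mult n_pos mult.commute)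
    show "j mod (2 * n) < 2 * n" using n_pos by simp
    show "j = 2 * n * (j div (2 * n)) + j mod (2 * n)" by simp
  qed
  have below_cap: "coord y j < cap" if j: "j < T" for j
  proof -
    obtain m k where mk: "m < M" "k < 2 * n" "j = 2 * n * m + k" using block[OF j] by blast
    have "(\<kappa> * coord y j)\<^sup>2 \<le> 2 * real n * \<epsilon>\<^sup>2"
      using hardy[OF mk(1,2)] mult_left_mono[OF G_le[OF mk(1)], of "2 * real n"] mk(3) by simp
    also have "\<dots> < 4 * real n * \<epsilon>\<^sup>2" using n_pos eps_pos by simp
    also have "\<dots> = (\<kappa> * cap)\<^sup>2"
      unfolding kappa_cap n_b_squared[symmetric] by (simp add: power2_eq_square)
    finally have "(\<kappa> * coord y j)\<^sup>2 < (\<kappa> * cap)\<^sup>2" .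
    moreover have "0 \<le> \<kappa> * cap" using kappa_pos cap_pos by simp
    ultimately have "\<kappa> * coord y j < \<kappa> * cap" by (rule power_less_imp_less_base)
    then show ?thesis by (simp only: mult_less_cancel_left_pos[OF kappa_pos])
  qed
  have ball: "(\<Sum>j<T. (coord y j)\<^sup>2) < (D / 2)\<^sup>2"
  proof -
    have "\<kappa>\<^sup>2 * (\<Sum>j<T. (coord y j)\<^sup>2) = (\<Sum>m<M. \<Sum>k<2 * n. (\<kappa> * coord y (2 * n * m + k))\<^sup>2)"
      by (simp add: sum_blocks sum_distrib_left power_mult_distrib)
    also have "\<dots> \<le> (\<Sum>m<M. \<Sum>k<2 * n. 2 * real n * G m)"
      using hardy by (intro sum_mono) auto
    also have "\<dots> = (\<Sum>m<M. 4 * (real n)\<^sup>2 * G m)"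
      by (rule sum.cong) (simp_all add: power2_eq_square)
    also have "\<dots> = 4 * (real n)\<^sup>2 * (\<Sum>m<M. G m)" by (rule sum_distrib_left[symmetric])
    also have "\<dots> \<le> 4 * (real n)\<^sup>2 * \<epsilon>\<^sup>2" using sumG by (intro mult_left_mono) auto
    also have "\<dots> = (2 * real n * \<epsilon>)\<^sup>2" by (simp add: power_mult_distrib)
    also have "\<dots> < (\<kappa> * (D / 2))\<^sup>2"
    proof (rule power_strict_mono)
      have "0 < \<epsilon> * real n" using eps_pos n_pos by simp
      then have "2 * real n * \<epsilon> < L * D / 24" using n_le by (simp add: mult_ac)
      also have "\<dots> = \<kappa> * (D / 2)" by (simp add: \<kappa>_def)
      finally show "2 * real n * \<epsilon> < \<kappa> * (D / 2)" .
    qed (use eps_pos in auto)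
    finally have "\<kappa>\<^sup>2 * (\<Sum>j<T. (coord y j)\<^sup>2) < \<kappa>\<^sup>2 * (D / 2)\<^sup>2"
      by (simp only: power_mult_distrib)
    then show ?thesis by (simp only: mult_less_cancel_left_pos[OF zero_less_power[OF kappa_pos]])
  qed
  have res_le: "drive p j \<le> coord p j" if "j < T" for j
    by (rule dual_maximizer_residual[OF y ymax that below_cap[OF that] ball])
  have dual_0: "coord y j = 0" if "j < T" "drive p j < coord p j" for j
    by (rule dual_maximizer_zero[OF y ymax that])
  have incr: "coord p (2 * n * m + k) \<le> coord p (2 * n * m + Suc k)" if mk: "m < M" "Suc k < 2 * n" for m k
    using res_le[OF block_index_less[OF mk]] drive_inside[of "2 * n * m + k" p]
      block_index_Suc_mod[of k m] block_index_less[OF mk] mk(2) by simp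
  have mono: "coord p (2 * n * m + k) \<le> coord p (2 * n * m + l)" if "m < M" "k \<le> l" "l < 2 * n" for m k l
    using that(2,3)
  proof (induction l rule: dec_induct)
    case (step l)
    then show ?case using incr[OF that(1), of l] by simp
  qed simp
  have completed: "coord p (2 * n * m + i) \<ge> 3 * a"
    if m: "m < M" and dr: "drive p (2 * n * m) = a" and i: "n \<le> i" "i < 2 * n" for m i
  proof (rule ccontr)
    assume "\<not> ?thesis"
    then have low: "coord p (2 * n * m + i) < 3 * a" by simp
    have ge_a: "coord p (2 * n * m + k) \<ge> a" if "k < 2 * n" for k
      using res_le[OF block_index_less[OF m, of 0]] dr mono[OF m _ that, of 0] n_pos by simp
    \<comment> \<open>\<open>k\<close> is the length of the prefix of the block that has not reached the level \<open>3 * a\<close>\<close>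
    define k where "k = (LEAST k. k = 2 * n \<or> coord p (2 * n * m + k) \<ge> 3 * a)"
    have k_or: "k = 2 * n \<or> coord p (2 * n * m + k) \<ge> 3 * a"
      unfolding k_def by (rule LeastI[of _ "2 * n"]) simp
    have k_le: "k \<le> 2 * n" unfolding k_def by (rule Least_le) simp
    have prefix: "coord p (2 * n * m + l) < 3 * a" if "l < k" for l
      using not_less_Least[OF that[unfolded k_def]] by simp
    have ik: "i < k"
    proof (rule ccontr)
      assume "\<not> i < k"
      then show False using k_or mono[OF m, of k i] i low by auto
    qed
    have uk: "u m k = 0"
    proof (cases "k = 2 * n")
      case False
      then have k: "k < 2 * n" "coord p (2 * n * m + k) \<ge> 3 * a" using k_le k_or by auto
      obtain l where l: "k = Suc l" using ik by (cases k) auto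
      have "drive p (2 * n * m + k) = coord p (2 * n * m + l)"
        using drive_inside[of "2 * n * m + l" p] block_index_Suc_mod[of l m] block_index_less[OF m k(1)] k(1) l
        by simp
      also have "\<dots> < 3 * a" using prefix[of l] l by simp
      also note k(2)
      finally show ?thesis using dual_0[OF block_index_less[OF m k(1)]] k(1) by (simp add: u_def)
    qed (simp add: u_def)
    have "g m l \<le> \<kappa> * u m (Suc l) - \<kappa> * u m l - b" if l: "l < k" for l
    proof -
      have "plateau (coord p (2 * n * m + l) / a) = 1"
        using ge_a[of l] prefix[OF l] l k_le a_pos by (intro plateau_eq_1) (auto simp: field_simps)
      then show ?thesis using g_le[OF m, of l] l k_le by (simp add: right_diff_distrib)
    qed
    then have "(\<Sum>l<k. g m l) \<le> (\<Sum>l<k. (\<kappa> * u m (Suc l) - \<kappa> * u m l) - b)"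
      by (intro sum_mono) auto
    also have "\<dots> = \<kappa> * u m k - \<kappa> * u m 0 - real k * b"
      unfolding sum_subtractf[of "\<lambda>l. \<kappa> * u m (Suc l) - \<kappa> * u m l" "\<lambda>_. b"]
        sum_lessThan_telescope[of "\<lambda>l. \<kappa> * u m l"] by simp
    also have "\<dots> \<le> - (real k * b)"
      using uk y0[OF block_index_less[OF m, of 0]] kappa_pos n_pos by (simp add: u_def)
    finally have "real k * b \<le> - (\<Sum>l<k. g m l)" by simp
    then have "(real k * b)\<^sup>2 \<le> (- (\<Sum>l<k. g m l))\<^sup>2" using b_pos by (intro power_mono) auto
    also have "\<dots> = (\<Sum>l<k. g m l)\<^sup>2" by simp
    also have "\<dots> \<le> (\<Sum>l<k. (g m l)\<^sup>2) * real (card {..<k})"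
      by (rule sum_squared_le_sum_of_squares)
    also have "\<dots> \<le> G m * real k"
      unfolding G_def card_lessThan using k_le by (intro mult_right_mono sum_mono2) auto
    also have "\<dots> \<le> real n * b\<^sup>2 * real k"
      unfolding n_b_squared using G_le[OF m] by (intro mult_right_mono) auto
    finally have "real k * (real k * b\<^sup>2) \<le> real n * (real k * b\<^sup>2)"
      by (simp add: power2_eq_square mult_ac)
    moreover have "real k * b\<^sup>2 > 0" using ik b_pos by simp
    ultimately have "k \<le> n" by (simp only: mult_le_cancel_right_pos of_nat_le_iff)
    then show False using ik i by simp
  qed
  have "drive p (2 * n * m) = a" if "m < M" for m
    using that
  proof (induction m)
    case 0
    then show ?case by (simp add: drive_0)
  next
    case (Suc m)
    then show ?case by (intro drive_block_start completed) auto
  qed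
  then show ?thesis using completed[OF m] m i by blast
qed

section \<open>Lower bound\<close>

lemma partial_derivative:
  "((\<lambda>z. inner y (res z) + pot z) has_derivative (\<lambda>h. inner (gx z y) h)) (at z)"
proof -
  have "((\<lambda>z. (z, y)) has_derivative (\<lambda>h. (h, 0))) (at z)"
    by (intro has_derivative_Pair has_derivative_ident has_derivative_const)
  from has_derivative_compose[OF this objective_has_derivative] show ?thesis
    by (simp add: inner_prod_def)
qed

lemma proximal_point:
  assumes x: "x \<in> euclid T"
  obtains p y where "p \<in> euclid T" "y \<in> Y" "gx p y = (2 * L) *\<^sub>R (x - p)"
    "\<And>y'. y' \<in> Y \<Longrightarrow> inner y' (res p) \<le> inner y (res p)"
    "\<And>z. z \<in> euclid T \<Longrightarrow> primal I z + L * (norm (z - x))\<^sup>2 \<ge>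
      primal I p + L * (norm (p - x))\<^sup>2 + L / 2 * (norm (z - p))\<^sup>2"
proof (rule proximal_saddle_point[OF Y_compact Y_convex _ L_pos x])
  show "(L / 4)-lipschitz_on (euclid T) res"
    using res_lipschitz L_pos by (intro lipschitz_onI) (auto simp: dist_norm)
  show "continuous_on (euclid T) pot"
    using has_derivative_continuous[OF pot_has_derivative]
    by (intro continuous_at_imp_continuous_on) auto
  show "norm (gx z y - gx z' y) \<le> L * norm (z - z')"
    if "z \<in> euclid T" "z' \<in> euclid T" "y \<in> Y" for z z' y
  proof -
    have "norm (gx z y - gx z' y) \<le> 5 / 12 * L * norm (z - z')"
      using gx_lipschitz[OF that(1,2) that(3) that(3)] by simp
    also have "\<dots> \<le> L * norm (z - z')" using L_pos by (intro mult_right_mono) auto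
    finally show ?thesis .
  qed
  fix p y assume p: "p \<in> euclid T" and y: "y \<in> Y" and gp: "gx p y = (2 * L) *\<^sub>R (x - p)"
    and min: "\<And>z. z \<in> euclid T \<Longrightarrow> inner y (res z) + pot z + L * (norm (z - x))\<^sup>2 \<ge>
      inner y (res p) + pot p + L * (norm (p - x))\<^sup>2 + L / 2 * (norm (z - p))\<^sup>2"
    and ymax: "\<And>y'. y' \<in> Y \<Longrightarrow> inner y' (res p) \<le> inner y (res p)"
  show thesis
  proof (rule that[OF p y gp ymax])
    fix z assume z: "z \<in> euclid T"
    show "primal I z + L * (norm (z - x))\<^sup>2 \<ge>
      primal I p + L * (norm (p - x))\<^sup>2 + L / 2 * (norm (z - p))\<^sup>2"
      using min[OF z] objective_le_primal[OF y, of z] primal_le[OF ymax] by linarith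
  qed
next
  show "Y \<noteq> {}" using zero_in_Y by blast
  show "gx z y \<in> euclid T" for z y by (simp add: gx_def)
qed (rule partial_derivative)

text \<open>
  The last block of \<open>x\<close> is still zero, whereas near-stationarity would put its \<open>n\<close> sensors in \<open>p\<close> at
  \<open>3 * a\<close> or more. Then \<open>2 * L * norm (x - p)\<close> is at least \<open>6 * L * a * sqrt n = 72 * \<epsilon>\<close>.
\<close>

lemma output_not_stationary:
  assumes zr: "zero_respecting_on A I" "zr_primal A I q x" and q: "q \<le> n * (M - 1)"
  shows "moreau I (1 / (2 * L)) differentiable (at x within euclid (dimx I)) \<and>
    (\<exists>p. prox_set I (1 / (2 * L)) x = {p} \<and>
       norm (moreau_grad I (1 / (2 * L)) x) = norm (grad_map (1 / (2 * L)) x p) \<and>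
       norm (grad_map (1 / (2 * L)) x p) > \<epsilon>)"
proof -
  have supp: "supp x \<subseteq> revealed q"
    using supp_zr_primal[OF supp_iterate[OF zr(1)] zr(2)] .
  then have x: "x \<in> euclid T" by (rule supp_revealed_euclid)
  obtain p y where p: "p \<in> euclid T" and y: "y \<in> Y" and gp: "gx p y = (2 * L) *\<^sub>R (x - p)"
    and ymax: "\<And>y'. y' \<in> Y \<Longrightarrow> inner y' (res p) \<le> inner y (res p)"
    and min: "\<And>z. z \<in> euclid T \<Longrightarrow> primal I z + L * (norm (z - x))\<^sup>2 \<ge>
      primal I p + L * (norm (p - x))\<^sup>2 + L / 2 * (norm (z - p))\<^sup>2"
    using proximal_point[OF x] by blast
  have ex: "\<exists>p'\<in>setX I. \<forall>z\<in>setX I. primal I z + L * (norm (z - x'))\<^sup>2 \<ge>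
      primal I p' + L * (norm (p' - x'))\<^sup>2 + L / 2 * (norm (z - p'))\<^sup>2" if "x' \<in> setX I" for x'
  proof (rule proximal_point[of x'])
    show "x' \<in> euclid T" using that by simp
    fix p' assume "p' \<in> euclid T" "\<And>z. z \<in> euclid T \<Longrightarrow> primal I z + L * (norm (z - x'))\<^sup>2 \<ge>
      primal I p' + L * (norm (p' - x'))\<^sup>2 + L / 2 * (norm (z - p'))\<^sup>2"
    then show ?thesis unfolding I_simps by blast
  qed
  have X: "setX I = euclid (dimx I)" "x \<in> setX I" "p \<in> setX I" using x p by simp_all
  have min': "primal I z + L * (norm (z - x))\<^sup>2 \<ge>
      primal I p + L * (norm (p - x))\<^sup>2 + L / 2 * (norm (z - p))\<^sup>2" if "z \<in> setX I" for z
    using min that by simp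
  have gm: "grad_map (1 / (2 * L)) x p = gx p y" by (simp add: grad_map_def gp)
  have "norm (gx p y) > \<epsilon>"
  proof (rule ccontr)
    assume "\<not> ?thesis"
    then have small: "norm (gx p y) \<le> \<epsilon>" by simp
    define m where "m = M - 1"
    have m: "m < M" using M_pos by (simp add: m_def)
    let ?S = "(\<lambda>i. 2 * n * m + i) ` {n..<2 * n}"
    have "3 * a \<le> \<bar>coord (x - p) j\<bar>" if j: "j \<in> ?S" for j
    proof -
      obtain i where "i \<in> {n..<2 * n}" "j = 2 * n * m + i" using j by blast
      then have i: "n \<le> i" "i < 2 * n" "j = 2 * n * m + i" by simp_all
      have "q \<le> depth j" using q i depth_block[OF i(2), of m] by (simp add: m_def)
      then have "coord x j = 0" by (rule coord_not_revealed[OF supp])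
      moreover have "3 * a \<le> coord p j"
        using near_stationary_completed[OF y ymax small m i(1,2)] i(3) by simp
      ultimately show ?thesis by simp
    qed
    then have "(3 * a)\<^sup>2 \<le> (coord (x - p) j)\<^sup>2" if "j \<in> ?S" for j
      using that a_pos by (subst abs_le_square_iff[symmetric]) auto
    then have "(\<Sum>j\<in>?S. (3 * a)\<^sup>2) \<le> (\<Sum>j\<in>?S. (coord (x - p) j)\<^sup>2)"
      by (intro sum_mono)
    moreover have "card ?S = n" by (subst card_image) (auto simp: inj_on_def)
    ultimately have "real n * (3 * a)\<^sup>2 \<le> (\<Sum>j\<in>?S. (coord (x - p) j)\<^sup>2)" by simp
    also have "\<dots> \<le> (\<Sum>j<T. (coord (x - p) j)\<^sup>2)"
    proof (rule sum_mono2)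
      show "?S \<subseteq> {..<T}" by (rule image_subsetI) (simp add: block_index_less[OF m])
    qed auto
    also have "\<dots> = (norm (x - p))\<^sup>2"
      using x p by (intro norm_euclid[symmetric] subspace_diff subspace_euclid)
    finally have "4 * L\<^sup>2 * (real n * (3 * a)\<^sup>2) \<le> 4 * L\<^sup>2 * (norm (x - p))\<^sup>2"
      by (intro mult_left_mono) auto
    also have "\<dots> = (norm (gx p y))\<^sup>2" by (simp add: gp power_mult_distrib)
    also have "\<dots> \<le> \<epsilon>\<^sup>2" using small by (intro power_mono) auto
    also have "4 * L\<^sup>2 * (real n * (3 * a)\<^sup>2) = 5184 * (real n * b\<^sup>2)"
      using L_pos by (simp add: a_def power2_eq_square)
    finally show False using eps_pos by (simp add: n_b_squared)
  qed
  moreover have "prox_set I (1 / (2 * L)) x = {p}"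
    "moreau I (1 / (2 * L)) differentiable (at x within euclid (dimx I))"
    "moreau_grad I (1 / (2 * L)) x = grad_map (1 / (2 * L)) x p"
    by (rule moreau_gradient[OF X(1) L_pos X(2,3) min' ex]; assumption)+
  ultimately show ?thesis by (intro conjI exI[of _ p]) (simp_all only: gm)
qed

end

theorem theorem4p1:
  shows "\<exists>c\<^sub>0 > 0. \<exists>c\<^sub>1 > 0. \<forall>L \<Delta> D \<epsilon> :: real.
    L > 0 \<and> \<Delta> > 0 \<and> D > 0 \<and> 0 < \<epsilon> \<and> \<epsilon> \<le> c\<^sub>1 * min (sqrt (L * \<Delta>)) (L * D) \<longrightarrow>
    (\<exists>I \<in> NCC L \<Delta> D. diameter (setY I) = D \<and>
       (\<forall>A q x. zero_respecting_on A I \<and> zr_primal A I q x \<and>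
          real q < c\<^sub>0 * L\<^sup>2 * D * \<Delta> / \<epsilon> ^ 3 \<longrightarrow>
          moreau I (1 / (2 * L)) differentiable (at x within euclid (dimx I)) \<and>
          (\<exists>p. prox_set I (1 / (2 * L)) x = {p} \<and>
             norm (moreau_grad I (1 / (2 * L)) x) = norm (grad_map (1 / (2 * L)) x p) \<and>
             norm (grad_map (1 / (2 * L)) x p) > \<epsilon>))) \<and>
    ereal (c\<^sub>0 * L\<^sup>2 * D * \<Delta> / \<epsilon> ^ 3) \<le> ereal_of_enat (oracle_complexity L \<Delta> D \<epsilon>)"
proof -
  define c\<^sub>0 :: real where "c\<^sub>0 = 1 / (192 * 912)"
  define c\<^sub>1 :: real where "c\<^sub>1 = 1 / 96"
  have main: "(\<exists>I \<in> NCC L \<Delta> D. diameter (setY I) = D \<and>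
       (\<forall>A q x. zero_respecting_on A I \<and> zr_primal A I q x \<and>
          real q < c\<^sub>0 * L\<^sup>2 * D * \<Delta> / \<epsilon> ^ 3 \<longrightarrow>
          moreau I (1 / (2 * L)) differentiable (at x within euclid (dimx I)) \<and>
          (\<exists>p. prox_set I (1 / (2 * L)) x = {p} \<and>
             norm (moreau_grad I (1 / (2 * L)) x) = norm (grad_map (1 / (2 * L)) x p) \<and>
             norm (grad_map (1 / (2 * L)) x p) > \<epsilon>))) \<and>
    ereal (c\<^sub>0 * L\<^sup>2 * D * \<Delta> / \<epsilon> ^ 3) \<le> ereal_of_enat (oracle_complexity L \<Delta> D \<epsilon>)"
    if pos: "L > 0" "\<Delta> > 0" "D > 0" "0 < \<epsilon>" and small: "\<epsilon> \<le> c\<^sub>1 * min (sqrt (L * \<Delta>)) (L * D)"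
    for L \<Delta> D \<epsilon> :: real
  proof -
    \<comment> \<open>\<open>\<alpha>\<close> and \<open>\<beta>\<close> are at least \<open>1\<close>, so rounding down loses at most a factor \<open>2\<close> each; with one block
      in reserve, \<open>(24 + 216 * (N + 1)) * \<epsilon>\<^sup>2 / L \<le> 456 * N * \<epsilon>\<^sup>2 / L \<le> \<Delta>\<close>\<close>
    define \<alpha> where "\<alpha> = L * D / (96 * \<epsilon>)"
    define \<beta> where "\<beta> = L * \<Delta> / (456 * \<epsilon>\<^sup>2)"
    have "96 * \<epsilon> \<le> L * D" using small by (simp add: c\<^sub>1_def)
    then have \<alpha>: "\<alpha> \<ge> 1" using pos by (simp add: \<alpha>_def)
    have "96 * \<epsilon> \<le> sqrt (L * \<Delta>)" using small by (simp add: c\<^sub>1_def)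
    then have "(96 * \<epsilon>)\<^sup>2 \<le> (sqrt (L * \<Delta>))\<^sup>2" using pos by (intro power_mono) auto
    then have "9216 * \<epsilon>\<^sup>2 \<le> L * \<Delta>" using pos by (simp add: power_mult_distrib)
    then have "456 * \<epsilon>\<^sup>2 \<le> L * \<Delta>" using zero_le_power2[of \<epsilon>] by linarith
    then have \<beta>: "\<beta> \<ge> 1" using pos by (simp add: \<beta>_def)
    have floor: "real (nat \<lfloor>t\<rfloor>) \<le> t \<and> t / 2 \<le> real (nat \<lfloor>t\<rfloor>) \<and> 0 < nat \<lfloor>t\<rfloor>" if "t \<ge> 1" for t :: real
    proof -
      have "1 \<le> \<lfloor>t\<rfloor>" using that by simp
      then have "real (nat \<lfloor>t\<rfloor>) = of_int \<lfloor>t\<rfloor>" "0 < nat \<lfloor>t\<rfloor>" "1 \<le> real_of_int \<lfloor>t\<rfloor>" by simp_all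
      then show ?thesis using floor_correct[of t] by linarith
    qed
    define n where "n = nat \<lfloor>\<alpha>\<rfloor>"
    define N where "N = nat \<lfloor>\<beta>\<rfloor>"
    have n: "real n \<le> \<alpha>" "\<alpha> / 2 \<le> real n" "n > 0" unfolding n_def using floor[OF \<alpha>] by blast+
    have N: "real N \<le> \<beta>" "\<beta> / 2 \<le> real N" "N > 0" unfolding N_def using floor[OF \<beta>] by blast+
    interpret chain_instance L D \<epsilon> n "Suc N"
    proof
      show "96 * \<epsilon> * real n \<le> L * D" using n(1) pos by (simp add: \<alpha>_def field_simps)
    qed (use pos n in auto)
    have "(24 + 216 * real (Suc N)) * \<epsilon>\<^sup>2 / L \<le> 456 * real N * \<epsilon>\<^sup>2 / L"
      using N(3) pos by (intro divide_right_mono mult_right_mono) auto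
    also have "\<dots> \<le> 456 * \<beta> * \<epsilon>\<^sup>2 / L"
      using N(1) pos by (intro divide_right_mono mult_right_mono mult_left_mono) auto
    also have "\<dots> = \<Delta>" using pos by (simp add: \<beta>_def)
    finally have NCC: "I \<in> NCC L \<Delta> D" by (rule I_in_NCC)
    have "c\<^sub>0 * L\<^sup>2 * D * \<Delta> / \<epsilon> ^ 3 = (\<alpha> / 2) * (\<beta> / 2)"
      using pos by (simp add: c\<^sub>0_def \<alpha>_def \<beta>_def power2_eq_square power3_eq_cube mult_ac)
    also have "\<dots> \<le> real n * real N"
      using n N \<alpha> \<beta> by (intro mult_mono) auto
    finally have budget: "c\<^sub>0 * L\<^sup>2 * D * \<Delta> / \<epsilon> ^ 3 \<le> real (n * N)" by simp
    have hard: "moreau I (1 / (2 * L)) differentiable (at x within euclid (dimx I)) \<and>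
          (\<exists>p. prox_set I (1 / (2 * L)) x = {p} \<and>
             norm (moreau_grad I (1 / (2 * L)) x) = norm (grad_map (1 / (2 * L)) x p) \<and>
             norm (grad_map (1 / (2 * L)) x p) > \<epsilon>)"
      if "zero_respecting_on A I" "zr_primal A I q x" "real q < c\<^sub>0 * L\<^sup>2 * D * \<Delta> / \<epsilon> ^ 3" for A q x
    proof -
      have "real q < real (n * N)" using that(3) budget by (rule less_le_trans)
      then have "q \<le> n * N" unfolding of_nat_less_iff by (rule less_imp_le)
      with that(1,2) show ?thesis by (intro output_not_stationary) auto
    qed
    have "ereal (c\<^sub>0 * L\<^sup>2 * D * \<Delta> / \<epsilon> ^ 3) \<le> ereal_of_enat (oracle_complexity L \<Delta> D \<epsilon>)"
    proof -
      \<comment> \<open>the complexity is an extended natural number, so the bound is first rounded up\<close>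
      define k where "k = nat \<lceil>c\<^sub>0 * L\<^sup>2 * D * \<Delta> / \<epsilon> ^ 3\<rceil>"
      have "enat k \<le> calls_needed L \<epsilon> A I" if A: "A \<in> zr_algorithms (NCC L \<Delta> D)" for A
        unfolding calls_needed_def
      proof (rule INF_greatest, simp)
        fix q assume q: "eps_stationary L I \<epsilon> (output_after A I q)"
        have "zero_respecting_on A I" "zr_primal A I q (output_after A I q)"
          using A NCC by (auto simp: zr_algorithms_def)
        then have "\<not> real q < c\<^sub>0 * L\<^sup>2 * D * \<Delta> / \<epsilon> ^ 3"
          using hard q by (fastforce simp: eps_stationary_def)
        then show "k \<le> q" by (simp add: k_def ceiling_le_iff nat_le_iff)
      qed
      then have "enat k \<le> oracle_complexity L \<Delta> D \<epsilon>"
        unfolding oracle_complexity_def using NCC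
        by (intro INF_greatest SUP_upper2[of I]) auto
      then have "ereal_of_enat (enat k) \<le> ereal_of_enat (oracle_complexity L \<Delta> D \<epsilon>)"
        by (simp only: ereal_of_enat_le_iff)
      moreover have "c\<^sub>0 * L\<^sup>2 * D * \<Delta> / \<epsilon> ^ 3 \<le> real k"
        unfolding k_def by (rule of_nat_ceiling)
      then have "ereal (c\<^sub>0 * L\<^sup>2 * D * \<Delta> / \<epsilon> ^ 3) \<le> ereal_of_enat (enat k)" by simp
      ultimately show ?thesis by (rule order.trans[rotated])
    qed
    then show ?thesis using NCC Y_diameter hard by (intro conjI bexI[of _ I]) auto
  qed
  show ?thesis
  proof (rule exI[of _ c\<^sub>0], rule conjI, simp add: c\<^sub>0_def,
      rule exI[of _ c\<^sub>1], rule conjI, simp add: c\<^sub>1_def, intro allI impI, elim conjE)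
  qed (rule main)
qed

end
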